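(* Let $d\ge1$, $\mu>-\frac12$, $\beta>-d$, $\gamma>-1$ with $2\mu+\beta+d>0$, and $n\ge0$. The family of polynomials $\{\mathsf{U}^{\mathsf J}_{\mathbf k,n}:\mathbf k\in\mathbb{N}_0^d,\ |\mathbf k|\le n\}$ is a basis of $\mathcal{V}_n(\mathbb{V}^{d+1},W_{\beta,\gamma,\mu})$.
   Context: $\mathbb{V}^{d+1}=\{(x,t):\|x\|\le t,\ x\in\mathbb{R}^d,\ 0\le t\le1\}$ and $W_{\beta,\gamma,\mu}(x,t)=(t^2-\|x\|^2)^{\mu-\frac12}t^\beta(1-t)^\gamma$. $\mathcal{V}_n(\mathbb{V}^{d+1},W_{\beta,\gamma,\mu})$ is the space of polynomials of degree at most $n$ in $(x,t)$ orthogonal to all polynomials of degree at most $n-1$ with respect to $\langle f,g\rangle=\int_{\mathbb{V}^{d+1}}fg\,W_{\beta,\gamma,\mu}\,dx\,dt$. For $\mathbf k\in\mathbb{N}_0^d$ with $|\mathbf k|=k_1+\cdots+k_d=k$, $0\le k\le n$, $$\mathsf{U}^{\mathsf J}_{\mathbf k,n}(x,t)=\frac{1}{W_{\beta,\gamma,\mu}(x,t)}\,\frac{1}{t^{2k+2\mu+d-1}}\left[\frac{\partial^{\mathbf k}}{\partial x^{\mathbf k}}(t^2-\|x\|^2)^{k+\mu-\frac12}\right]\left[\frac{\partial^{n-k}}{\partial t^{n-k}}\bigl(t^{n+k+\beta+2\mu+d-1}(1-t)^{\gamma+n-k}\bigr)\right],$$ where $\frac{\partial^{\mathbf k}}{\partial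 x^{\mathbf k}}=\frac{\partial^{k}}{\partial x_1^{k_1}\cdots\partial x_d^{k_d}}$ (this expression, defined in the interior of the cone, is a polynomial in $(x,t)$). *)

theory Defs
  imports "HOL-Analysis.Analysis" "HOL-Library.Function_Algebras"
begin

text \<open>Pointwise scaling, so that \<open>span\<close> and \<open>independent\<close> apply to spaces of real functions.\<close>

instantiation "fun" :: (type, real_vector) real_vector
begin

definition scaleR_fun :: "real \<Rightarrow> ('a \<Rightarrow> 'b) \<Rightarrow> 'a \<Rightarrow> 'b"
  where "scaleR_fun c f = (\<lambda>x. c *\<^sub>R f x)"

instance
  by standard (auto simp: scaleR_fun_def fun_eq_iff algebra_simps)

end

definition basis_family :: "('i \<Rightarrow> 'v::real_vector) \<Rightarrow> 'i set \<Rightarrow> 'v set \<Rightarrow> bool"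
  where "basis_family u I V \<longleftrightarrow> inj_on u I \<and> independent (u ` I) \<and> span (u ` I) = V"

definition solid_cone :: "((real ^ 'd) \<times> real) set"
  where "solid_cone = {(x, t). norm x \<le> t \<and> 0 \<le> t \<and> t \<le> 1}"

definition cone_weight :: "real \<Rightarrow> real \<Rightarrow> real \<Rightarrow> (real ^ 'd) \<times> real \<Rightarrow> real"
  where "cone_weight \<beta> \<gamma> \<mu> = (\<lambda>(x, t).
    (t\<^sup>2 - (norm x)\<^sup>2) powr (\<mu> - 1/2) * t powr \<beta> * (1 - t) powr \<gamma>)"

definition cone_inner ::
    "real \<Rightarrow> real \<Rightarrow> real \<Rightarrow> ((real ^ 'd) \<times> real \<Rightarrow> real) \<Rightarrow> ((real ^ 'd) \<times> real \<Rightarrow> real) \<Rightarrow> real"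
  where "cone_inner \<beta> \<gamma> \<mu> f g = (LINT z:solid_cone|lborel. f z * g z * cone_weight \<beta> \<gamma> \<mu> z)"

definition multi_abs :: "nat ^ 'd \<Rightarrow> nat"
  where "multi_abs k = (\<Sum>i\<in>UNIV. k $ i)"

definition monomial_fun :: "nat ^ 'd \<Rightarrow> nat \<Rightarrow> (real ^ 'd) \<times> real \<Rightarrow> real"
  where "monomial_fun a j = (\<lambda>(x, t). (\<Prod>i\<in>UNIV. x $ i ^ (a $ i)) * t ^ j)"

text \<open>Polynomials in \<open>(x, t)\<close> are identified with polynomial functions. The bound on the total
  degree is strict, so that \<open>polys_lt 0 = {0}\<close> is the space of polynomials of degree at most \<open>-1\<close>.\<close>

definition polys_lt :: "nat \<Rightarrow> ((real ^ 'd) \<times> real \<Rightarrow> real) set"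
  where "polys_lt n = span {monomial_fun a j | a j. multi_abs a + j < n}"

definition orth_polys :: "real \<Rightarrow> real \<Rightarrow> real \<Rightarrow> nat \<Rightarrow> ((real ^ 'd) \<times> real \<Rightarrow> real) set"
  where "orth_polys \<beta> \<gamma> \<mu> n =
    {p \<in> polys_lt (Suc n). \<forall>q \<in> polys_lt n. cone_inner \<beta> \<gamma> \<mu> p q = 0}"

definition partial_deriv :: "'d \<Rightarrow> (real ^ 'd \<Rightarrow> real) \<Rightarrow> real ^ 'd \<Rightarrow> real"
  where "partial_deriv i f x = deriv (\<lambda>s. f (x + s *\<^sub>R axis i 1)) 0"

text \<open>The order on the index type only serves to write the coordinates as \<open>x\<^sub>1, \<dots>, x\<^sub>d\<close>; the
  derivative in \<open>x\<^sub>1\<close> is the outermost one.\<close>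

definition multi_partial ::
    "nat ^ 'd::{finite,linorder} \<Rightarrow> (real ^ 'd::{finite,linorder} \<Rightarrow> real) \<Rightarrow> real ^ 'd::{finite,linorder} \<Rightarrow> real"
  where "multi_partial k f = foldr (\<lambda>i. partial_deriv i ^^ (k $ i)) (sorted_list_of_set UNIV) f"

definition rodrigues_cone ::
    "real \<Rightarrow> real \<Rightarrow> real \<Rightarrow> nat \<Rightarrow> nat ^ 'd::{finite,linorder} \<Rightarrow> (real ^ 'd::{finite,linorder}) \<times> real \<Rightarrow> real"
  where "rodrigues_cone \<beta> \<gamma> \<mu> n kv = (\<lambda>(x, t).
    let k = multi_abs kv; d = real CARD('d) in
      1 / cone_weight \<beta> \<gamma> \<mu> (x, t)
      * (1 / t powr (2 * real k + 2 * \<mu> + d - 1))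
      * multi_partial kv (\<lambda>y. (t\<^sup>2 - (norm y)\<^sup>2) powr (real k + \<mu> - 1/2)) x
      * (deriv ^^ (n - k))
          (\<lambda>s. s powr (real n + real k + \<beta> + 2 * \<mu> + d - 1)
               * (1 - s) powr (\<gamma> + real n - real k)) t)"

text \<open>The Rodrigues expression is meaningful only in the interior of the cone, where it agrees with
  a polynomial; that polynomial is unique because the interior is a nonempty open set.\<close>

definition UJ ::
    "real \<Rightarrow> real \<Rightarrow> real \<Rightarrow> nat \<Rightarrow> nat ^ 'd::{finite,linorder} \<Rightarrow> (real ^ 'd::{finite,linorder}) \<times> real \<Rightarrow> real"
  where "UJ \<beta> \<gamma> \<mu> n kv = (THE p. p \<in> (\<Union>m. polys_lt m) \<and>
    (\<forall>z \<in> interior solid_cone. p z = rodrigues_cone \<beta> \<gamma> \<mu> n kv z))"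

end

theory Submission
  imports Defs
begin

text \<open>
  In the interior of the cone the Rodrigues expression is \<open>P (x, t) * q t\<close> with \<open>P\<close> a polynomial of
  degree \<open>k\<close> and \<open>q\<close> one of degree \<open>n - k\<close>. Integrating by parts, first in \<open>x\<close> and then in \<open>t\<close>,
  its inner product with the monomial \<open>x\<^sup>j t\<^sup>i\<close> factors as \<open>A(k, j) * B(k, i + \<bar>j\<bar>)\<close>, where
  \<open>A(k, j) = 0\<close> unless \<open>k \<le> j\<close> componentwise, \<open>A(k, k) \<noteq> 0\<close>, \<open>B(k, s) = 0\<close> for \<open>s < n\<close> and
  \<open>B(k, n) \<noteq> 0\<close>. Orthogonality to lower degree, and linear independence by triangularity, are both
  read off from this. Since the inner product is definite, \<open>orth_polys\<close> meets \<open>polys_lt n\<close> trivially, and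
  there are as many multi-indices \<open>k\<close> with \<open>\<bar>k\<bar> \<le> n\<close> as monomials of degree exactly \<open>n\<close>, so the
  family spans.
\<close>

section \<open>Polynomials on the cone\<close>

text \<open>The singularities of the weight dictate the order of integration. For
  \<open>\<mu> < 1/2\<close> the weight blows up on the lateral boundary, and for
  \<open>\<beta> \<le> -1\<close> the factor \<open>t powr \<beta>\<close> is not integrable near 0.
  Only the slice integral over \<open>norm x < t\<close>, a multiple of
  \<open>t powr (2 * \<mu> + d - 1)\<close>, repairs the latter, and
  \<open>2 * \<mu> + \<beta> + d > 0\<close> is exactly the resulting condition. Hence slices at
  fixed \<open>t\<close> are integrated first. The weight on a slice is homogeneous, so each slice
  integral is a constant times a power of \<open>t\<close>. The constant is A; the power joins
  \<open>t powr \<beta>\<close> to form \<open>t powr \<alpha>\<close> with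
  \<open>\<alpha> = 2 * k + 2 * \<mu> + \<beta> + d - 1\<close>, the weight for which the factor in
  \<open>t\<close> is a Jacobi polynomial on [0, 1]. This explains the exponents in the Rodrigues
  formula. Both A and B are found by induction on the number of derivatives: moving one derivative
  onto a monomial lowers one exponent by one and multiplies by minus that exponent. Vanishing,
  triangularity and the nonzero diagonal all come from this factor.\<close>

lemma polys_lt_mono: "m \<le> n \<Longrightarrow> polys_lt m \<subseteq> polys_lt n"
  unfolding polys_lt_def by (intro span_mono) fastforce

lemma zero_in_polys_lt [intro, simp]: "(\<lambda>z. 0) \<in> polys_lt n"
  unfolding polys_lt_def zero_fun_def[symmetric] by (rule span_zero)

lemma polys_lt_add [intro]:
  "f \<in> polys_lt n \<Longrightarrow> g \<in> polys_lt n \<Longrightarrow> (\<lambda>z. f z + g z) \<in> polys_lt n"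
  unfolding polys_lt_def using span_add by (force simp: plus_fun_def)

lemma polys_lt_cmult [intro]:
  "f \<in> polys_lt n \<Longrightarrow> (\<lambda>z. c * f z) \<in> polys_lt n"
  unfolding polys_lt_def using span_scale[of f _ c] by (simp add: scaleR_fun_def)

lemma polys_lt_diff [intro]:
  "f \<in> polys_lt n \<Longrightarrow> g \<in> polys_lt n \<Longrightarrow> (\<lambda>z. f z - g z) \<in> polys_lt n"
  using polys_lt_add[OF _ polys_lt_cmult[of g n "-1"], of f] by simp

lemma polys_lt_sum [intro]:
  "(\<And>i. i \<in> I \<Longrightarrow> f i \<in> polys_lt n) \<Longrightarrow> (\<lambda>z. \<Sum>i\<in>I. f i z) \<in> polys_lt n"
  by (induction I rule: infinite_finite_induct) auto

lemma monomial_fun_in_polys_lt: "multi_abs a + j < n \<Longrightarrow> monomial_fun a j \<in> polys_lt n"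
  unfolding polys_lt_def by (intro span_base) auto

text \<open>Span induction with the operations written pointwise. The summands keep their membership
  in \<open>polys_lt n\<close> because additivity of the inner product needs it for
  integrability.\<close>

lemma polys_lt_induct [consumes 1, case_names zero add cmult monomial]:
  assumes "p \<in> polys_lt n"
    and zero: "P (\<lambda>z. 0)"
    and add: "\<And>f g. f \<in> polys_lt n \<Longrightarrow> g \<in> polys_lt n \<Longrightarrow> P f \<Longrightarrow> P g \<Longrightarrow> P (\<lambda>z. f z + g z)"
    and cmult: "\<And>c f. f \<in> polys_lt n \<Longrightarrow> P f \<Longrightarrow> P (\<lambda>z. c * f z)"
    and monomial: "\<And>a j. multi_abs a + j < n \<Longrightarrow> P (monomial_fun a j)"
  shows "P p"
proof -
  have "p \<in> polys_lt n \<and> P p"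
    using assms(1) unfolding polys_lt_def
  proof (induction rule: span_induct)
    case base
    show ?case
      unfolding subspace_def polys_lt_def[symmetric]
      using zero add cmult
      by (auto simp: zero_fun_def plus_fun_def scaleR_fun_def)
  next
    case (step x)
    then show ?case using monomial by (auto intro: span_base)
  qed
  then show ?thesis ..
qed

lemma multi_abs_add: "multi_abs (a + b) = multi_abs a + multi_abs b"
  by (simp add: multi_abs_def sum.distrib)

lemma multi_abs_0 [simp]: "multi_abs 0 = 0"
  by (simp add: multi_abs_def)

lemma multi_abs_axis [simp]: "multi_abs (axis i m) = m"
  by (simp add: multi_abs_def axis_def if_distrib sum.delta cong: if_cong)

lemma multi_index_split: "(a :: nat ^ 'd::finite) $ i > 0 \<Longrightarrow> a = (a - axis i 1) + axis i 1"
  by (auto simp: vec_eq_iff axis_def)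

lemma multi_abs_diff_axis: "a $ i > 0 \<Longrightarrow> Suc (multi_abs (a - axis i 1)) = multi_abs a"
  using multi_index_split[of a i] multi_abs_add[of "a - axis i 1" "axis i 1"] by simp

lemma multi_abs_mono: "(\<And>i. a $ i \<le> b $ i) \<Longrightarrow> multi_abs a \<le> multi_abs b"
  by (auto simp: multi_abs_def intro: sum_mono)

lemma multi_abs_eq_imp_eq:
  assumes "\<And>i. a $ i \<le> b $ i" "multi_abs b \<le> multi_abs a"
  shows "a = b"
proof -
  have "multi_abs a = multi_abs b" using multi_abs_mono[of a b] assms by simp
  then have "\<And>i. a $ i = b $ i"
    using sum_mono_inv[of "($) a" UNIV "($) b"] assms(1) by (simp add: multi_abs_def)
  then show ?thesis by (simp add: vec_eq_iff)
qed

lemma monomial_fun_mult: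
  "monomial_fun a i z * monomial_fun b j z = monomial_fun (a + b) (i + j) z"
  by (cases z) (simp add: monomial_fun_def power_add prod.distrib mult_ac)

text \<open>The degree bounds are strict, so degrees \<open>m\<close> and \<open>n\<close> appear as
  \<open>Suc m\<close> and \<open>Suc n\<close>; a factor from \<open>polys_lt 0\<close> has to be
  treated separately.\<close>

lemma polys_lt_mult:
  assumes f: "f \<in> polys_lt (Suc m)" and g: "g \<in> polys_lt (Suc n)"
  shows "(\<lambda>z. f z * g z) \<in> polys_lt (Suc (m + n))"
  using f
proof (induction rule: polys_lt_induct)
  case (monomial a i)
  show ?case
    using g
  proof (induction rule: polys_lt_induct)
    case (monomial b j)
    then show ?case
      using \<open>multi_abs a + i < Suc m\<close>
      by (auto simp: monomial_fun_mult multi_abs_add intro!: monomial_fun_in_polys_lt)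
  next
    case (add f g)
    then show ?case using polys_lt_add by (fastforce simp: ring_distribs)
  next
    case (cmult c f)
    then show ?case using polys_lt_cmult[of "\<lambda>z. monomial_fun a i z * f z"] by (simp add: mult_ac)
  qed simp
next
  case (add f g)
  then show ?case using polys_lt_add by (fastforce simp: ring_distribs)
next
  case (cmult c f)
  then show ?case using polys_lt_cmult[of "\<lambda>z. f z * g z"] by (simp add: mult_ac)
qed simp

lemma polys_lt_const: "(\<lambda>z :: (real ^ 'd::finite) \<times> real. c) \<in> polys_lt (Suc n)"
proof -
  have "(\<lambda>z :: (real ^ 'd::finite) \<times> real. 1) = monomial_fun 0 0"
    by (auto simp: monomial_fun_def)
  then have "(\<lambda>z :: (real ^ 'd::finite) \<times> real. 1) \<in> polys_lt (Suc n)"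
    by (simp add: monomial_fun_in_polys_lt)
  from polys_lt_cmult[OF this, of c] show ?thesis by simp
qed

lemma polys_lt_coord: "(\<lambda>z :: (real ^ 'd::finite) \<times> real. fst z $ i) \<in> polys_lt (Suc 1)"
proof -
  have "(\<lambda>z :: (real ^ 'd::finite) \<times> real. fst z $ i) = monomial_fun (axis i 1) 0"
  proof
    fix z :: "(real ^ 'd::finite) \<times> real"
    have "(\<Prod>j\<in>UNIV. fst z $ j ^ (axis i 1 :: nat ^ 'd::finite) $ j)
        = (\<Prod>j\<in>UNIV. if j = i then fst z $ j else 1)"
      by (intro prod.cong) (auto simp: axis_def)
    then show "fst z $ i = monomial_fun (axis i 1) 0 z"
      by (simp add: monomial_fun_def case_prod_beta)
  qed
  then show ?thesis by (simp add: monomial_fun_in_polys_lt)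
qed

lemma polys_lt_poly:
  assumes "degree q \<le> m"
  shows "(\<lambda>z. poly q (snd z)) \<in> polys_lt (Suc m)"
proof -
  have "(\<lambda>z. coeff q i * monomial_fun 0 i z) \<in> polys_lt (Suc m)" if "i \<le> degree q" for i
    using that assms by (intro polys_lt_cmult monomial_fun_in_polys_lt) auto
  then show ?thesis
    unfolding poly_altdef using polys_lt_sum[of "{..degree q}"]
    by (force simp: monomial_fun_def case_prod_beta)
qed

lemma polys_lt_cone_form: "(\<lambda>z :: (real ^ 'd::finite) \<times> real. (snd z)\<^sup>2 - (norm (fst z))\<^sup>2) \<in> polys_lt (Suc 2)"
proof -
  have "(\<lambda>z. fst z $ i * fst z $ i) \<in> polys_lt (Suc 2)" for i :: "'d::finite"
    using polys_lt_mult[OF polys_lt_coord polys_lt_coord, of i i] by (simp add: numeral_2_eq_2)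
  then have "(\<lambda>z :: (real ^ 'd::finite) \<times> real. \<Sum>i\<in>UNIV. fst z $ i * fst z $ i) \<in> polys_lt (Suc 2)"
    by (intro polys_lt_sum)
  moreover have "(norm x)\<^sup>2 = (\<Sum>i\<in>UNIV. x $ i * x $ i)" for x :: "real ^ 'd::finite"
    by (metis inner_vec_def power2_norm_eq_inner inner_real_def)
  moreover have "(\<lambda>z :: (real ^ 'd::finite) \<times> real. (snd z)\<^sup>2) \<in> polys_lt (Suc 2)"
    using polys_lt_poly[of "monom 1 2" 2] by (simp add: degree_monom_eq poly_monom)
  ultimately show ?thesis by (auto intro: polys_lt_diff)
qed

section \<open>Partial derivatives of polynomials\<close>

lemma monomial_fun_partial:
  "((\<lambda>s. monomial_fun a j (x + s *\<^sub>R axis i 1, t)) has_real_derivative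
      real (a $ i) * monomial_fun (a - axis i 1) j (x + s *\<^sub>R axis i 1, t)) (at s)"
proof -
  define c where "c = (\<Prod>l\<in>UNIV - {i}. x $ l ^ a $ l)"
  have coord: "(x + s *\<^sub>R axis i 1) $ l = (if l = i then x $ i + s else x $ l)" for s l
    by (auto simp: axis_def)
  have *: "monomial_fun b j (x + s *\<^sub>R axis i 1, t)
      = (x $ i + s) ^ (b $ i) * (\<Prod>l\<in>UNIV - {i}. x $ l ^ b $ l) * t ^ j" for s b
  proof -
    have "(\<Prod>l\<in>UNIV. (if l = i then x $ i + s else x $ l) ^ b $ l)
      = (x $ i + s) ^ (b $ i) * (\<Prod>l\<in>UNIV - {i}. (if l = i then x $ i + s else x $ l) ^ b $ l)"
      by (subst prod.remove[of _ i]) auto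
    also have "(\<Prod>l\<in>UNIV - {i}. (if l = i then x $ i + s else x $ l) ^ b $ l)
      = (\<Prod>l\<in>UNIV - {i}. x $ l ^ b $ l)" by (intro prod.cong) auto
    finally show ?thesis unfolding monomial_fun_def prod.case coord by simp
  qed
  have "(\<Prod>l\<in>UNIV - {i}. x $ l ^ (a - axis i 1) $ l) = c"
    unfolding c_def by (intro prod.cong) (auto simp: axis_def)
  then show ?thesis
    unfolding * c_def[symmetric]
    by (auto intro!: derivative_eq_intros)
qed

text \<open>The derivative is described at every point of a line, and by one polynomial for all
  \<open>t\<close>: the fundamental theorem will be applied along segments, on every slice.\<close>

lemma polys_lt_partial:
  assumes "p \<in> polys_lt (Suc m)"
  shows "\<exists>p'\<in>polys_lt m. \<forall>x t s. ((\<lambda>s. p (x + s *\<^sub>R axis i 1, t)) has_real_derivative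
      p' (x + s *\<^sub>R axis i 1, t)) (at s)"
  using assms
proof (induction rule: polys_lt_induct)
  case zero
  then show ?case by (intro bexI[of _ "\<lambda>z. 0"]) auto
next
  case (add f g)
  then obtain f' g' where "f' \<in> polys_lt m" "g' \<in> polys_lt m"
    "\<forall>x t s. ((\<lambda>s. f (x + s *\<^sub>R axis i 1, t)) has_real_derivative f' (x + s *\<^sub>R axis i 1, t)) (at s)"
    "\<forall>x t s. ((\<lambda>s. g (x + s *\<^sub>R axis i 1, t)) has_real_derivative g' (x + s *\<^sub>R axis i 1, t)) (at s)"
    by blast
  then show ?case by (intro bexI[of _ "\<lambda>z. f' z + g' z"]) (auto intro: DERIV_add)
next
  case (cmult c f)
  then obtain f' where "f' \<in> polys_lt m"
    "\<forall>x t s. ((\<lambda>s. f (x + s *\<^sub>R axis i 1, t)) has_real_derivative f' (x + s *\<^sub>R axis i 1, t)) (at s)"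
    by blast
  then show ?case by (intro bexI[of _ "\<lambda>z. c * f' z"]) (auto intro: DERIV_cmult)
next
  case (monomial a j)
  \<comment> \<open>If \<open>a $ i = 0\<close>, truncated subtraction does not lower the degree,
    but then the factor in front is zero.\<close>
  have "(\<lambda>z. real (a $ i) * monomial_fun (a - axis i 1) j z) \<in> polys_lt m"
  proof (cases "a $ i = 0")
    case False
    then show ?thesis
      using multi_abs_diff_axis[of a i] monomial by (intro polys_lt_cmult monomial_fun_in_polys_lt) auto
  qed simp
  then show ?case
    by (intro bexI[of _ "\<lambda>z. real (a $ i) * monomial_fun (a - axis i 1) j z"])
      (use monomial_fun_partial in blast)+
qed

section \<open>Continuity and the identity principle\<close>

lemma continuous_on_polys_lt:
  assumes "p \<in> polys_lt n"
  shows "continuous_on S p"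
  using assms
  by (induction rule: polys_lt_induct)
    (auto simp: monomial_fun_def case_prod_beta intro!: continuous_intros)

lemma polys_lt_line:
  assumes "p \<in> polys_lt n"
  shows "\<exists>q. \<forall>s. p (z + s *\<^sub>R w) = poly q s"
  using assms
proof (induction rule: polys_lt_induct)
  case zero
  then show ?case by (intro exI[of _ 0]) simp
next
  case (add f g)
  then obtain q r where "\<forall>s. f (z + s *\<^sub>R w) = poly q s" "\<forall>s. g (z + s *\<^sub>R w) = poly r s" by blast
  then show ?case by (intro exI[of _ "q + r"]) simp
next
  case (cmult c f)
  then obtain q where "\<forall>s. f (z + s *\<^sub>R w) = poly q s" by blast
  then show ?case by (intro exI[of _ "smult c q"]) simp
next
  case (monomial a j)
  show ?case
    by (intro exI[of _ "(\<Prod>i\<in>UNIV. [:fst z $ i, fst w $ i:] ^ (a $ i)) * [:snd z, snd w:] ^ j"])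
      (simp add: monomial_fun_def case_prod_beta poly_prod)
qed

text \<open>On the line from \<open>z\<close> to any \<open>y\<close> the restriction is a
  univariate polynomial with infinitely many zeros near \<open>z\<close>, so it also vanishes at
  \<open>y\<close>. Used for the definiteness of the inner product and for the uniqueness hidden in
  \<open>UJ\<close>.\<close>

lemma polys_lt_eq_zero:
  assumes p: "p \<in> polys_lt n" and S: "open S" "z \<in> S" and zero: "\<And>y. y \<in> S \<Longrightarrow> p y = 0"
  shows "p = (\<lambda>z. 0)"
proof
  fix y
  obtain q where q: "\<And>s. p (z + s *\<^sub>R (y - z)) = poly q s"
    using polys_lt_line[OF p] by blast
  have "open ((\<lambda>s. z + s *\<^sub>R (y - z)) -` S)"
    using S(1) by (intro open_vimage) (auto intro!: continuous_intros)
  moreover have "0 \<in> (\<lambda>s. z + s *\<^sub>R (y - z)) -` S" using S by simp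
  ultimately have "infinite ((\<lambda>s. z + s *\<^sub>R (y - z)) -` S)"
    using finite_imp_not_open by blast
  moreover have "(\<lambda>s. z + s *\<^sub>R (y - z)) -` S \<subseteq> {s. poly q s = 0}"
    using zero q[symmetric] by auto
  ultimately have "q = 0" using poly_roots_finite infinite_super by blast
  then show "p y = 0" using q[of 1] by simp
qed

section \<open>Integration over Euclidean space and balls\<close>

lemma integral_lborel_scale:
  fixes f :: "'a::euclidean_space \<Rightarrow> real"
  assumes [measurable]: "f \<in> borel_measurable borel" and "c > 0"
  shows "(LINT x|lborel. f x) = c ^ DIM('a) * (LINT x|lborel. f (c *\<^sub>R x))"
  using assms(2)
  by (subst lborel_affine[of c 0]) (simp_all add: integral_density integral_distr)

lemma nn_integral_lborel_scale:
  fixes f :: "'a::euclidean_space \<Rightarrow> ennreal"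
  assumes [measurable]: "f \<in> borel_measurable borel" and "c > 0"
  shows "(\<integral>\<^sup>+x. f x \<partial>lborel) = ennreal (c ^ DIM('a)) * (\<integral>\<^sup>+x. f (c *\<^sub>R x) \<partial>lborel)"
  using assms(2)
  by (subst lborel_affine[of c 0]) (simp_all add: nn_integral_density nn_integral_distr nn_integral_cmult)

lemma integral_lborel_translate:
  fixes f :: "'a::euclidean_space \<Rightarrow> real"
  assumes [measurable]: "f \<in> borel_measurable borel"
  shows "(LINT x|lborel. f (x + c)) = (LINT x|lborel. f x)"
  by (subst (2) lborel_distr_plus[of c, symmetric]) (simp add: integral_distr add.commute)

lemma integrable_lborel_translate:
  fixes f :: "'a::euclidean_space \<Rightarrow> real"
  assumes "integrable lborel f"
  shows "integrable lborel (\<lambda>x. f (x + c))"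
proof -
  from assms have [measurable]: "f \<in> borel_measurable borel" by simp
  have "integrable (distr lborel borel ((+) c)) f"
    using assms by (simp add: lborel_distr_plus)
  then show ?thesis by (simp add: integrable_distr_eq add.commute)
qed

text \<open>Averaging over translates: the integral of \<open>g\<close> equals that of
  \<open>\<integral>\<^sub>0\<^sup>1 g (x + s *\<^sub>R e) ds = f (x + e) - f x\<close>, which vanishes by translation invariance. This avoids
  slicing the space into coordinates.\<close>

lemma integral_directional_derivative_eq_0:
  fixes f g :: "'a::euclidean_space \<Rightarrow> real"
  assumes f: "integrable lborel f" and g: "integrable lborel g"
    and ftc: "\<And>x. ((\<lambda>s. g (x + s *\<^sub>R e)) has_integral (f (x + e) - f x)) {0..1}"
  shows "(LINT x|lborel. g x) = 0"
proof -
  have [measurable]: "f \<in> borel_measurable borel" "g \<in> borel_measurable borel"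
    using f g by simp_all
  define h where "h = (\<lambda>s x. indicator {0..1} s * g (x + s *\<^sub>R e))"
  have h_meas [measurable]: "case_prod h \<in> borel_measurable (lborel \<Otimes>\<^sub>M lborel)"
    unfolding h_def by measurable
  have h_int: "integrable lborel (h s)" for s
    unfolding h_def by (intro integrable_mult_right integrable_lborel_translate g)
  have pair: "integrable (lborel \<Otimes>\<^sub>M lborel) (case_prod h)"
  proof (rule lborel_pair.Fubini_integrable)
    \<comment> \<open>All translates of \<open>g\<close> have the same L1 norm, so the outer
      integrand is constant on [0, 1] and Fubini applies.\<close>
    have "(LINT x|lborel. norm (h s x)) = indicator {0..1} s * (LINT x|lborel. norm (g x))" for s
      using integral_lborel_translate[of "\<lambda>x. norm (g x)" "s *\<^sub>R e"]
      by (simp add: h_def abs_mult)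
    then show "integrable lborel (\<lambda>s. LINT x|lborel. norm (case (s, x) of (s, x) \<Rightarrow> h s x))"
      by simp
  qed (use h_int in auto)
  have "(LINT s|lborel. LINT x|lborel. h s x) = (LINT x|lborel. LINT s|lborel. h s x)"
    using lborel_pair.Fubini_integral[OF pair] ..
  moreover have "(LINT s|lborel. LINT x|lborel. h s x) = (LINT x|lborel. g x)"
    unfolding h_def by (simp add: integral_lborel_translate)
  \<comment> \<open>The hypothesis \<open>ftc\<close> is about the gauge integral. It agrees with
    the Lebesgue integral where the section in \<open>s\<close> is Lebesgue integrable, which Fubini
    gives for almost every \<open>x\<close>.\<close>
  moreover have "AE x in lborel. (LINT s|lborel. h s x) = f (x + e) - f x"
    using lborel_pair.AE_integrable_snd[OF pair]
  proof eventually_elim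
    case (elim x)
    then have "set_integrable lborel {0..1} (\<lambda>s. g (x + s *\<^sub>R e))"
      by (simp add: set_integrable_def h_def)
    from set_borel_integral_eq_integral(2)[OF this] show ?case
      using integral_unique[OF ftc[of x]] by (simp add: set_lebesgue_integral_def h_def)
  qed
  then have "(LINT x|lborel. LINT s|lborel. h s x) = (LINT x|lborel. f (x + e) - f x)"
    by (intro integral_cong_AE) auto
  moreover have "(LINT x|lborel. f (x + e) - f x) = 0"
    using f integrable_lborel_translate[OF f, of e] by (simp add: integral_lborel_translate)
  ultimately show ?thesis by simp
qed

text \<open>Extended by zero to the whole space, so that translations act on it. The open ball loses
  nothing on the sphere, where the base is 0 and \<open>0 powr a = 0\<close>; for
  \<open>t \<le> 0\<close> the function is zero.\<close>

definition ball_weight :: "real \<Rightarrow> real \<Rightarrow> 'a::euclidean_space \<Rightarrow> real"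
  where "ball_weight t a x = indicator (ball 0 t) x * (t\<^sup>2 - (norm x)\<^sup>2) powr a"

lemma ball_weight_nonneg: "ball_weight t a x \<ge> 0"
  by (simp add: ball_weight_def)

lemma ball_weight_pair_measurable [measurable]:
  "(\<lambda>z. ball_weight (snd z) a (fst z)) \<in> borel_measurable (borel \<Otimes>\<^sub>M borel)"
proof -
  have "(\<lambda>z. ball_weight (snd z) a (fst z :: 'a)) =
    (\<lambda>z. if norm (fst z) < snd z then ((snd z)\<^sup>2 - (norm (fst z))\<^sup>2) powr a else 0)"
    by (auto simp: ball_weight_def fun_eq_iff)
  then show ?thesis by simp
qed

lemma ball_weight_measurable [measurable]: "ball_weight t a \<in> borel_measurable borel"
proof -
  have "(\<lambda>x. ball_weight (snd (x, t)) a (fst (x, t) :: 'a)) \<in> borel_measurable borel"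
    by measurable
  then show ?thesis by simp
qed

text \<open>This homogeneity, together with the Jacobian \<open>t ^ d\<close>, is the source of
  every power of \<open>t\<close> in the slice integrals.\<close>

lemma ball_weight_scale:
  assumes "t > 0"
  shows "ball_weight t a (t *\<^sub>R x) = t powr (2 * a) * ball_weight 1 a x"
proof -
  have "t\<^sup>2 - (norm (t *\<^sub>R x))\<^sup>2 = t\<^sup>2 * (1 - (norm x)\<^sup>2)"
    by (simp add: power_mult_distrib algebra_simps)
  moreover have "(t\<^sup>2) powr a = t powr (2 * a)"
    using assms by (simp flip: powr_numeral add: powr_powr)
  moreover have "norm (t *\<^sub>R x) < t \<longleftrightarrow> norm x < 1"
    using assms by simp
  ultimately show ?thesis
    by (auto simp: ball_weight_def powr_mult power_le_one indicator_def abs_square_le_1)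
qed

lemma nn_integral_ball_weight:
  assumes "t > 0"
  shows "(\<integral>\<^sup>+x. ball_weight t a (x::'a) \<partial>lborel) =
    ennreal (t powr (2 * a + DIM('a))) * (\<integral>\<^sup>+x. ball_weight 1 a (x::'a::euclidean_space) \<partial>lborel)"
proof -
  have "(\<integral>\<^sup>+x. ball_weight t a (x::'a) \<partial>lborel) =
      ennreal (t ^ DIM('a)) * (\<integral>\<^sup>+x. ennreal (t powr (2 * a)) * ball_weight 1 a (x::'a) \<partial>lborel)"
    using assms by (subst nn_integral_lborel_scale[of _ t])
      (auto simp: ball_weight_scale ennreal_mult' )
  also have "\<dots> = ennreal (t ^ DIM('a)) * ennreal (t powr (2 * a)) * (\<integral>\<^sup>+x. ball_weight 1 a (x::'a) \<partial>lborel)"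
    by (simp add: nn_integral_cmult mult.assoc)
  also have "ennreal (t ^ DIM('a)) * ennreal (t powr (2 * a)) = ennreal (t powr (2 * a + DIM('a)))"
    using assms by (simp add: powr_add powr_realpow mult_ac flip: ennreal_mult'')
  finally show ?thesis .
qed

lemma powr_le_powr_abs:
  fixes x a b :: real
  assumes "1 \<le> x" "x \<le> b"
  shows "x powr a \<le> b powr \<bar>a\<bar>"
proof -
  have "x powr a \<le> x powr \<bar>a\<bar>" using assms by (intro powr_mono) auto
  also have "\<dots> \<le> b powr \<bar>a\<bar>" using assms by (intro powr_mono2) auto
  finally show ?thesis .
qed

lemma nn_integral_powr_from_0:
  assumes "a > (- 1 :: real)" "c \<ge> 0"
  shows "(\<integral>\<^sup>+u. ennreal (indicator {0..c} u * u powr a) \<partial>lborel) = ennreal (c powr (a + 1) / (a + 1))"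
proof (rule nn_integral_has_integral_lborel)
  show "((\<lambda>u. indicator {0..c} u * u powr a) has_integral c powr (a + 1) / (a + 1)) UNIV"
    using has_integral_powr_from_0[OF assms] has_integral_restrict_UNIV[of "{0..c}" "\<lambda>u. u powr a"]
    by (simp add: indicator_def of_bool_def if_distrib[of "\<lambda>c. c * _"] cong: if_cong)
qed auto

text \<open>For \<open>a < 0\<close> the integral over \<open>x\<close> alone is singular at the sphere. Integrating additionally over
  the radius \<open>t \<in> [1, 2]\<close> only multiplies it by a positive constant, by homogeneity, and after Tonelli
  the inner integral becomes one of \<open>(t - norm x) powr a\<close>.\<close>

lemma nn_integral_ball_weight_finite:
  assumes a: "a > - 1"
  shows "(\<integral>\<^sup>+x. ball_weight 1 a (x::'a::euclidean_space) \<partial>lborel) < \<infinity>"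
proof -
  define N where "N = (\<integral>\<^sup>+x. ball_weight 1 a (x::'a) \<partial>lborel)"
  define e where "e = 2 * a + DIM('a)"
  \<comment> \<open>\<open>c\<close> is a lower bound of \<open>t powr e\<close> on [1, 2]. In
    \<open>K\<close>, the first factor bounds \<open>(t + norm x) powr a\<close>, as
    \<open>1 \<le> t + norm x \<le> 4\<close>; the second is the integral of \<open>u powr a\<close>
    over [0, 2], where \<open>u = t - norm x\<close>. The absolute values cover both signs of the
    exponents.\<close>
  define c where "c = 1 / 2 powr \<bar>e\<bar>"
  define K where "K = 4 powr \<bar>a\<bar> * (2 powr (a + 1) / (a + 1))"
  have "c > 0" by (simp add: c_def)
  have K: "ennreal K = ennreal (4 powr \<bar>a\<bar>) * ennreal (2 powr (a + 1) / (a + 1))"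
    unfolding K_def using a by (intro ennreal_mult) auto
  have c: "c \<le> t powr e" if "1 \<le> t" "t \<le> 2" for t
    using powr_le_powr_abs[of t 2 "- e"] that by (simp add: c_def powr_minus field_simps)
  have "ennreal c * N = (\<integral>\<^sup>+t. ennreal c * N * indicator {1..2} (t::real) \<partial>lborel)"
    by (simp add: nn_integral_cmult_indicator)
  also have "\<dots> \<le> (\<integral>\<^sup>+t. indicator {1..2} t * (\<integral>\<^sup>+x. ball_weight t a (x::'a) \<partial>lborel) \<partial>lborel)"
  proof (rule nn_integral_mono)
    fix t :: real
    show "ennreal c * N * indicator {1..2} t \<le> indicator {1..2} t * (\<integral>\<^sup>+x. ball_weight t a (x::'a) \<partial>lborel)"
    proof (cases "t \<in> {1..2}")
      case True
      then have "(\<integral>\<^sup>+x. ball_weight t a (x::'a) \<partial>lborel) = ennreal (t powr e) * N"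
        using nn_integral_ball_weight[of t a] by (simp add: N_def e_def)
      then show ?thesis using True c[of t] by (auto intro!: mult_right_mono ennreal_leI)
    qed simp
  qed
  also have "\<dots> = (\<integral>\<^sup>+t. \<integral>\<^sup>+x. ennreal (indicator {1..2} t * ball_weight t a (x::'a)) \<partial>lborel \<partial>lborel)"
    by (simp add: nn_integral_cmult ennreal_mult' flip: ennreal_indicator)
  also have "\<dots> = (\<integral>\<^sup>+x. \<integral>\<^sup>+t. ennreal (indicator {1..2} t * ball_weight t a (x::'a)) \<partial>lborel \<partial>lborel)"
    by (rule lborel_pair.Fubini') (simp add: case_prod_beta)
  also have "\<dots> \<le> (\<integral>\<^sup>+x. ennreal K * indicator (ball 0 2) (x::'a) \<partial>lborel)"
  proof (rule nn_integral_mono)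
    fix x :: 'a
    define r where "r = norm x"
    have bound: "indicator {1..2} t * ball_weight t a x
        \<le> 4 powr \<bar>a\<bar> * (indicator {0..2} (t - r) * (t - r) powr a) * indicator (ball 0 2) x" for t
    proof (cases "t \<in> {1..2} \<and> r < t")
      case True
      have "t\<^sup>2 - r\<^sup>2 = (t + r) * (t - r)" by (simp add: power2_eq_square algebra_simps)
      moreover have "((t + r) * (t - r)) powr a = (t + r) powr a * (t - r) powr a"
        by (rule powr_mult)
      moreover have "(t + r) powr a \<le> 4 powr \<bar>a\<bar>"
        using True by (intro powr_le_powr_abs) (auto simp: r_def intro: add_increasing2)
      ultimately have "(t\<^sup>2 - r\<^sup>2) powr a \<le> 4 powr \<bar>a\<bar> * (t - r) powr a"
        by (simp add: mult_right_mono)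
      moreover have "t - r \<in> {0..2}" "r < 2" using True by (auto simp: r_def intro: order_trans[of _ t])
      ultimately show ?thesis using True by (simp add: ball_weight_def r_def)
    qed (auto simp: ball_weight_def r_def)
    have "(\<integral>\<^sup>+t. ennreal (indicator {1..2} t * ball_weight t a x) \<partial>lborel)
      \<le> (\<integral>\<^sup>+t. ennreal (4 powr \<bar>a\<bar> * (indicator {0..2} (t - r) * (t - r) powr a) * indicator (ball 0 2) x) \<partial>lborel)"
      by (intro nn_integral_mono ennreal_leI bound)
    also have "\<dots> = ennreal (4 powr \<bar>a\<bar>) * (\<integral>\<^sup>+t. ennreal (indicator {0..2} (t - r) * (t - r) powr a) \<partial>lborel)
        * indicator (ball 0 2) x"
      by (simp add: nn_integral_cmult nn_integral_multc ennreal_mult' ennreal_mult'' flip: ennreal_indicator)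
    also have "(\<integral>\<^sup>+t. ennreal (indicator {0..2} (t - r) * (t - r) powr a) \<partial>lborel)
        = (\<integral>\<^sup>+u. ennreal (indicator {0..2} u * u powr a) \<partial>lborel)"
      using nn_integral_real_affine[of "\<lambda>u. ennreal (indicator {0..2} u * u powr a)" 1 "- r"]
      by (simp add: algebra_simps)
    also have "\<dots> = ennreal (2 powr (a + 1) / (a + 1))"
      using a by (intro nn_integral_powr_from_0) auto
    finally show "(\<integral>\<^sup>+t. ennreal (indicator {1..2} t * ball_weight t a x) \<partial>lborel) \<le> ennreal K * indicator (ball 0 2) x"
      by (simp only: K)
  qed
  also have "\<dots> = ennreal K * emeasure lborel (ball 0 2 :: 'a set)"
    by (simp add: nn_integral_cmult_indicator)
  also have "\<dots> < \<infinity>"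
    using emeasure_bounded_finite[of "ball 0 2 :: 'a set"]
    by (simp add: ennreal_mult_less_top)
  finally have "N < \<infinity>"
    using \<open>c > 0\<close> by (auto simp: ennreal_mult_less_top ennreal_mult_eq_top_iff less_top)
  then show ?thesis by (simp add: N_def)
qed

lemma integrable_ball_weight:
  assumes "a > - 1" "t > 0"
  shows "integrable lborel (ball_weight t a :: 'a::euclidean_space \<Rightarrow> real)"
proof (rule integrableI_bounded)
  show "(\<integral>\<^sup>+x. ennreal (norm (ball_weight t a (x::'a))) \<partial>lborel) < \<infinity>"
    using nn_integral_ball_weight_finite[OF assms(1), where 'a='a]
    by (simp add: ball_weight_nonneg nn_integral_ball_weight[OF assms(2)] ennreal_mult_less_top)
qed simp

lemma integrable_ball_weight_mult:
  assumes "a > - 1" "t > 0" and q: "continuous_on UNIV q"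
  shows "integrable lborel (\<lambda>x :: 'a::euclidean_space. ball_weight t a x * q x)"
proof -
  have "bounded (q ` cball 0 t)"
    by (intro compact_imp_bounded compact_continuous_image continuous_on_subset[OF q]) auto
  then obtain M where M: "\<And>x. norm x \<le> t \<Longrightarrow> \<bar>q x\<bar> \<le> M"
    by (force simp: bounded_iff)
  have [measurable]: "q \<in> borel_measurable borel"
    using q by (rule borel_measurable_continuous_onI)
  show ?thesis
  proof (rule Bochner_Integration.integrable_bound)
    show "integrable lborel (\<lambda>x :: 'a. M * ball_weight t a x)"
      using integrable_ball_weight[OF assms(1,2), where 'a='a] by simp
    have "norm (ball_weight t a x * q x) \<le> norm (M * ball_weight t a x)" for x
    proof (cases "norm x < t")
      case True
      then have "\<bar>q x\<bar> \<le> \<bar>M\<bar>" using M[of x] by simp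
      then show ?thesis by (simp add: abs_mult mult.commute mult_right_mono)
    qed (simp add: ball_weight_def)
    then show "AE x in lborel. norm (ball_weight t a x * q x) \<le> norm (M * ball_weight t a x)"
      by simp
  qed simp
qed

section \<open>Integration by parts on a ball\<close>

lemma cone_form_pos_iff:
  fixes x :: "'a::real_normed_vector"
  assumes "t > 0"
  shows "0 < t\<^sup>2 - (norm x)\<^sup>2 \<longleftrightarrow> norm x < t"
  using assms power_strict_mono[of "norm x" t 2] power2_less_imp_less[of "norm x" t] by auto

text \<open>The integrand is the derivative of \<open>ball_weight t b x * r x\<close> in direction
  \<open>e\<close>. Because \<open>b > 0\<close>, that product is continuous across the sphere, so
  no boundary term arises, and \<open>b - 1 > -1\<close> keeps the derivative integrable.\<close>

lemma integral_ball_weight_directional: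
  fixes r r' :: "'a::euclidean_space \<Rightarrow> real"
  assumes b: "b > 0" and t: "t > 0" and e: "e \<noteq> 0"
    and r: "continuous_on UNIV r" and r': "continuous_on UNIV r'"
    and deriv: "\<And>x s. ((\<lambda>s. r (x + s *\<^sub>R e)) has_real_derivative r' (x + s *\<^sub>R e)) (at s)"
  shows "(LINT x|lborel. ball_weight t (b - 1) x *
    (- 2 * b * (x \<bullet> e) * r x + (t\<^sup>2 - (norm x)\<^sup>2) * r' x)) = 0"
proof (rule integral_directional_derivative_eq_0[where f = "\<lambda>x. ball_weight t b x * r x" and e = e])
  show "integrable lborel (\<lambda>x. ball_weight t b x * r x)"
    using b t r by (intro integrable_ball_weight_mult) auto
  show "integrable lborel (\<lambda>x. ball_weight t (b - 1) x *
    (- 2 * b * (x \<bullet> e) * r x + (t\<^sup>2 - (norm x)\<^sup>2) * r' x))"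
    using b t r r' by (intro integrable_ball_weight_mult continuous_intros) auto
  fix x :: 'a
  define \<phi> where "\<phi> = (\<lambda>s. t\<^sup>2 - (norm (x + s *\<^sub>R e))\<^sup>2)"
  define R where "R = (\<lambda>s. r (x + s *\<^sub>R e))"
  have \<phi>_eq: "t\<^sup>2 - (norm (x + s *\<^sub>R e))\<^sup>2 = \<phi> s" for s by (simp add: \<phi>_def)
  have \<phi>_poly: "\<phi> s = poly [: t\<^sup>2 - x \<bullet> x, - 2 * (x \<bullet> e), - (e \<bullet> e) :] s" for s
    by (simp add: \<phi>_def power2_norm_eq_inner algebra_simps inner_commute)
  have \<phi>_cont: "continuous_on S \<phi>" for S
    unfolding \<phi>_def by (intro continuous_intros)
  have \<phi>_deriv: "(\<phi> has_real_derivative - 2 * ((x + s *\<^sub>R e) \<bullet> e)) (at s)" for s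
  proof -
    have "((poly [: t\<^sup>2 - x \<bullet> x, - 2 * (x \<bullet> e), - (e \<bullet> e) :]) has_real_derivative
        - 2 * ((x + s *\<^sub>R e) \<bullet> e)) (at s)"
      by (rule DERIV_cong[OF poly_DERIV]) (simp add: pderiv_pCons inner_add_left)
    moreover have "\<phi> = poly [: t\<^sup>2 - x \<bullet> x, - 2 * (x \<bullet> e), - (e \<bullet> e) :]"
      using \<phi>_poly by blast
    ultimately show ?thesis by (simp only:)
  qed
  have weight: "ball_weight t a (x + s *\<^sub>R e) = (if 0 < \<phi> s then \<phi> s powr a else 0)" for a s
    using cone_form_pos_iff[OF t, of "x + s *\<^sub>R e"]
    by (simp add: ball_weight_def \<phi>_def indicator_def)
  have F: "ball_weight t b (x + s *\<^sub>R e) * r (x + s *\<^sub>R e) = max 0 (\<phi> s) powr b * R s" for s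
    by (auto simp: weight R_def max_def)
  have R_cont: "continuous_on S R" for S
    unfolding R_def by (intro continuous_on_compose2[OF r] continuous_intros) auto
  have "((\<lambda>s. ball_weight t (b - 1) (x + s *\<^sub>R e) * (- 2 * b * ((x + s *\<^sub>R e) \<bullet> e) * r (x + s *\<^sub>R e)
      + (t\<^sup>2 - (norm (x + s *\<^sub>R e))\<^sup>2) * r' (x + s *\<^sub>R e))) has_integral
      max 0 (\<phi> 1) powr b * R 1 - max 0 (\<phi> 0) powr b * R 0) {0..1}"
  \<comment> \<open>The line meets the sphere where the quadratic \<open>\<phi>\<close> vanishes, in
    at most two points since \<open>e \<noteq> 0\<close>. There the antiderivative need only be
    continuous, which \<open>max 0\<close> and \<open>b > 0\<close> provide.\<close>
  proof (rule fundamental_theorem_of_calculus_interior_strong[where S = "{s. \<phi> s = 0}"])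
    show "finite {s. \<phi> s = 0}"
      unfolding \<phi>_poly using e by (intro poly_roots_finite) simp
    show "continuous_on {0..1} (\<lambda>s. max 0 (\<phi> s) powr b * R s)"
      using b by (intro continuous_on_mult continuous_on_powr' R_cont continuous_on_max \<phi>_cont
          continuous_on_const) auto
  next
    fix s :: real
    assume s: "s \<in> {0<..<1} - {s. \<phi> s = 0}"
    show "((\<lambda>s. max 0 (\<phi> s) powr b * R s) has_vector_derivative
      ball_weight t (b - 1) (x + s *\<^sub>R e) * (- 2 * b * ((x + s *\<^sub>R e) \<bullet> e) * r (x + s *\<^sub>R e)
      + (t\<^sup>2 - (norm (x + s *\<^sub>R e))\<^sup>2) * r' (x + s *\<^sub>R e))) (at s)"
    proof (cases "\<phi> s > 0")
      case True
      have "((\<lambda>s. \<phi> s powr b * R s) has_real_derivative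
        b * \<phi> s powr (b - 1) * (- 2 * ((x + s *\<^sub>R e) \<bullet> e)) * R s + r' (x + s *\<^sub>R e) * \<phi> s powr b) (at s)"
        using DERIV_mult[OF DERIV_fun_powr[OF \<phi>_deriv True, of b] deriv[of x s]]
        by (simp add: R_def)
      then have "((\<lambda>s. \<phi> s powr b * R s) has_real_derivative
        ball_weight t (b - 1) (x + s *\<^sub>R e) * (- 2 * b * ((x + s *\<^sub>R e) \<bullet> e) * r (x + s *\<^sub>R e)
          + (t\<^sup>2 - (norm (x + s *\<^sub>R e))\<^sup>2) * r' (x + s *\<^sub>R e))) (at s)"
      proof (rule DERIV_cong)
        have "\<phi> s powr b = \<phi> s powr (b - 1) * \<phi> s" using True by (simp add: powr_diff)
        then show "b * \<phi> s powr (b - 1) * (- 2 * ((x + s *\<^sub>R e) \<bullet> e)) * R s + r' (x + s *\<^sub>R e) * \<phi> s powr b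
          = ball_weight t (b - 1) (x + s *\<^sub>R e) * (- 2 * b * ((x + s *\<^sub>R e) \<bullet> e) * r (x + s *\<^sub>R e)
          + (t\<^sup>2 - (norm (x + s *\<^sub>R e))\<^sup>2) * r' (x + s *\<^sub>R e))"
          using True unfolding \<phi>_eq weight R_def by (simp add: distrib_left right_diff_distrib mult_ac)
      qed
      moreover have "open {s. \<phi> s > 0}"
        using \<phi>_cont by (intro open_Collect_less continuous_intros) auto
      ultimately show ?thesis
        unfolding has_real_derivative_iff_has_vector_derivative[symmetric]
        using True by (elim has_field_derivative_transform_within_open[of _ _ _ "{s. \<phi> s > 0}"]) auto
    next
      case False
      then have neg: "\<phi> s < 0" using s by auto
      have "open {s. \<phi> s < 0}"
        using \<phi>_cont by (intro open_Collect_less continuous_intros) auto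
      then have "((\<lambda>s. max 0 (\<phi> s) powr b * R s) has_real_derivative 0) (at s)"
        by (rule has_field_derivative_transform_within_open[OF DERIV_const[of 0]]) (use neg in auto)
      then show ?thesis
        using neg by (simp add: weight has_real_derivative_iff_has_vector_derivative)
    qed
  qed simp
  then show "((\<lambda>s. ball_weight t (b - 1) (x + s *\<^sub>R e) * (- 2 * b * ((x + s *\<^sub>R e) \<bullet> e) * r (x + s *\<^sub>R e)
      + (t\<^sup>2 - (norm (x + s *\<^sub>R e))\<^sup>2) * r' (x + s *\<^sub>R e))) has_integral
      ball_weight t b (x + e) * r (x + e) - ball_weight t b x * r x) {0..1}"
    using F[of 0] F[of 1] by simp
qed

section \<open>The Rodrigues formula on the ball\<close>

lemma monomial_fun_scale:
  "monomial_fun j 0 (c *\<^sub>R x, s) = c ^ multi_abs j * monomial_fun j 0 (x, s)"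
  by (simp add: monomial_fun_def power_mult_distrib prod.distrib multi_abs_def power_sum)

lemma integral_ball_weight_pos:
  assumes "a > - 1"
  shows "(LINT x|lborel. ball_weight 1 a (x :: 'a::euclidean_space)) > 0"
proof -
  have int: "integrable lborel (ball_weight 1 a :: 'a \<Rightarrow> real)"
    using assms by (intro integrable_ball_weight) auto
  have "\<not> (AE x in lborel. ball_weight 1 a (x :: 'a) = 0)"
  proof
    assume "AE x in lborel. ball_weight 1 a (x :: 'a) = 0"
    then have "AE x in lborel. x \<notin> ball (0 :: 'a) 1"
    proof eventually_elim
      case (elim x)
      then show ?case
        using abs_square_less_1[of "norm x"] by (auto simp: ball_weight_def)
    qed
    then have "negligible (ball (0 :: 'a) 1)"
      using AE_iff_null_sets[of "ball (0 :: 'a) 1" lborel]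
      by (simp add: negligible_iff_null_sets null_sets_completionI)
    then show False using open_not_negligible[of "ball (0 :: 'a) 1"] by simp
  qed
  then have "(LINT x|lborel. ball_weight 1 a (x :: 'a)) \<noteq> 0"
    using integral_nonneg_eq_0_iff_AE[OF int] by (simp add: ball_weight_nonneg)
  moreover have "(LINT x|lborel. ball_weight 1 a (x :: 'a)) \<ge> 0"
    by (simp add: ball_weight_nonneg)
  ultimately show ?thesis by simp
qed

text \<open>The closed form of \<open>F\<close> is assumed inside the ball only, as derivatives are
  local. This lets the lemma be applied to an already differentiated function, whose closed form is
  known nowhere else. Each application costs one power of the cone form.\<close>

lemma partial_deriv_cone_form_powr:
  assumes eq: "\<And>x. norm x < t \<Longrightarrow> F x = (t\<^sup>2 - (norm x)\<^sup>2) powr b * p (x, t)"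
    and p': "\<And>x s. ((\<lambda>s. p (x + s *\<^sub>R axis i 1, t)) has_real_derivative p' (x + s *\<^sub>R axis i 1, t)) (at s)"
    and x: "norm x < t"
  shows "partial_deriv i F x = (t\<^sup>2 - (norm x)\<^sup>2) powr (b - 1) *
    (- 2 * b * x $ i * p (x, t) + (t\<^sup>2 - (norm x)\<^sup>2) * p' (x, t))"
proof -
  have w: "t\<^sup>2 - (norm x)\<^sup>2 > 0"
    using x by (simp add: power_strict_mono)
  have norm_sq: "(norm (x + s *\<^sub>R axis i 1))\<^sup>2 = (norm x)\<^sup>2 + 2 * s * x $ i + s\<^sup>2" for s
    unfolding power2_norm_eq_inner
    by (simp add: inner_add_left inner_add_right inner_axis inner_axis' power2_eq_square
        distrib_left)
  have "((\<lambda>s. t\<^sup>2 - (norm (x + s *\<^sub>R axis i 1))\<^sup>2) has_real_derivative - 2 * x $ i) (at 0)"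
    unfolding norm_sq by (auto intro!: derivative_eq_intros)
  from DERIV_fun_powr[OF this, of b] w
  have "((\<lambda>s. (t\<^sup>2 - (norm (x + s *\<^sub>R axis i 1))\<^sup>2) powr b) has_real_derivative
      b * (t\<^sup>2 - (norm x)\<^sup>2) powr (b - 1) * (- 2 * x $ i)) (at 0)"
    by simp
  from DERIV_mult[OF this p'[of x 0]]
  have "((\<lambda>s. (t\<^sup>2 - (norm (x + s *\<^sub>R axis i 1))\<^sup>2) powr b * p (x + s *\<^sub>R axis i 1, t)) has_real_derivative
      (t\<^sup>2 - (norm x)\<^sup>2) powr (b - 1) *
    (- 2 * b * x $ i * p (x, t) + (t\<^sup>2 - (norm x)\<^sup>2) * p' (x, t))) (at 0)"
    by (rule DERIV_cong) (use w in \<open>simp add: powr_diff field_simps\<close>)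
  moreover have "open {s :: real. norm (x + s *\<^sub>R axis i 1) < t}"
    by (intro open_Collect_less continuous_intros)
  ultimately have "((\<lambda>s. F (x + s *\<^sub>R axis i 1)) has_real_derivative
      (t\<^sup>2 - (norm x)\<^sup>2) powr (b - 1) *
    (- 2 * b * x $ i * p (x, t) + (t\<^sup>2 - (norm x)\<^sup>2) * p' (x, t))) (at 0)"
    by (elim has_field_derivative_transform_within_open[of _ _ _ "{s. norm (x + s *\<^sub>R axis i 1) < t}"])
      (use x eq in auto)
  then show ?thesis unfolding partial_deriv_def by (rule DERIV_imp_deriv)
qed

lemma polys_lt_slice_continuous: "p \<in> polys_lt n \<Longrightarrow> continuous_on S (\<lambda>x. p (x, t))"
  by (intro continuous_on_compose2[OF continuous_on_polys_lt[where S = UNIV]] continuous_intros) auto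

text \<open>A multi-index is unfolded into the list of its single derivatives, so that one induction
  step is one integration by parts. Each step multiplies the constant by minus the current exponent
  of the monomial: it dies as soon as an exponent is exhausted, and on the diagonal it is, up to
  sign, a product of factorials times the positive integral of \<open>ball_weight 1 a\<close>. The
  bound on \<open>a\<close> keeps every exponent positive until the last derivative is
  taken.\<close>

lemma ball_rodrigues:
  fixes L :: "'d::finite list"
  assumes "a > real (length L) - 1"
  shows "\<exists>P\<in>polys_lt (Suc (length L)).
    (\<forall>t x. norm x < t \<longrightarrow> foldr partial_deriv L (\<lambda>y. (t\<^sup>2 - (norm y)\<^sup>2) powr a) x
        = (t\<^sup>2 - (norm x)\<^sup>2) powr (a - length L) * P (x, t)) \<and>
    (\<forall>j. \<exists>A. (\<forall>t>0. (LINT x|lborel. ball_weight t (a - length L) x * (P (x, t) * monomial_fun j 0 (x, 0)))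
              = A * t powr (2 * a - length L + multi_abs j + real CARD('d))) \<and>
        (A \<noteq> 0 \<longrightarrow> (\<forall>i. count_list L i \<le> j $ i)) \<and>
        ((\<forall>i. count_list L i = j $ i) \<longrightarrow> A \<noteq> 0))"
  using assms
proof (induction L)
  case Nil
  show ?case
  proof (intro bexI[of _ "\<lambda>z. 1"] conjI allI)
    fix j :: "nat ^ 'd"
    define A where "A = (LINT x|lborel. ball_weight 1 a x * monomial_fun j 0 (x, 0))"
    have [measurable]: "(\<lambda>x. monomial_fun j 0 (x, 0)) \<in> borel_measurable borel"
      by (intro borel_measurable_continuous_onI polys_lt_slice_continuous[OF monomial_fun_in_polys_lt[OF lessI]])
    have "(LINT x|lborel. ball_weight t a x * monomial_fun j 0 (x, 0))
        = A * t powr (2 * a + multi_abs j + real CARD('d))" if "t > 0" for t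
    proof -
      have "(LINT x|lborel. ball_weight t a x * monomial_fun j 0 (x, 0))
        = t ^ CARD('d) * (LINT x|lborel. t powr (2 * a) * t ^ multi_abs j * (ball_weight 1 a x * monomial_fun j 0 (x, 0)))"
        using that by (subst integral_lborel_scale[of _ t])
          (auto simp: ball_weight_scale monomial_fun_scale mult_ac)
      also have "\<dots> = A * t powr (2 * a + multi_abs j + real CARD('d))"
        using that by (simp add: A_def powr_add powr_realpow)
      finally show ?thesis .
    qed
    moreover have "A \<noteq> 0" if "\<forall>i. 0 = j $ i"
    proof -
      have "monomial_fun j 0 (x, 0) = 1" for x :: "real ^ 'd"
        using that by (simp add: monomial_fun_def flip: that)
      then show ?thesis
        using integral_ball_weight_pos[of a, where 'a = "real ^ 'd"] Nil by (simp add: A_def)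
    qed
    ultimately show "\<exists>A. (\<forall>t>0. (LINT x|lborel. ball_weight t (a - length []) x * (1 * monomial_fun j 0 (x, 0)))
              = A * t powr (2 * a - length [] + multi_abs j + real CARD('d))) \<and>
        (A \<noteq> 0 \<longrightarrow> (\<forall>i. count_list [] i \<le> j $ i)) \<and>
        ((\<forall>i. count_list [] i = j $ i) \<longrightarrow> A \<noteq> 0)"
      by (intro exI[of _ A]) simp
  qed (auto simp: polys_lt_const)
next
  case (Cons i L)
  define b where "b = a - length L"
  have b: "b > 0" "a - length (i # L) = b - 1" using Cons.prems by (auto simp: b_def)
  from Cons obtain P where P: "P \<in> polys_lt (Suc (length L))"
    and foldr: "\<And>t x. norm x < t \<Longrightarrow> foldr partial_deriv L (\<lambda>y. (t\<^sup>2 - (norm y)\<^sup>2) powr a) x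
        = (t\<^sup>2 - (norm x)\<^sup>2) powr b * P (x, t)"
    and integral: "\<And>j. \<exists>A. (\<forall>t>0. (LINT x|lborel. ball_weight t b x * (P (x, t) * monomial_fun j 0 (x, 0)))
              = A * t powr (2 * a - length L + multi_abs j + real CARD('d))) \<and>
        (A \<noteq> 0 \<longrightarrow> (\<forall>i. count_list L i \<le> j $ i)) \<and>
        ((\<forall>i. count_list L i = j $ i) \<longrightarrow> A \<noteq> 0)"
    unfolding b_def by auto
  obtain P' where P': "P' \<in> polys_lt (length L)"
    and deriv: "\<And>x t s. ((\<lambda>s. P (x + s *\<^sub>R axis i 1, t)) has_real_derivative P' (x + s *\<^sub>R axis i 1, t)) (at s)"
    using polys_lt_partial[OF P, of i] by blast
  \<comment> \<open>What remains of the derivative of the cone form to the power \<open>b\<close>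
    times \<open>P\<close> after factoring out the power \<open>b - 1\<close>.\<close>
  define Q where "Q = (\<lambda>z. - 2 * b * fst z $ i * P z + ((snd z)\<^sup>2 - (norm (fst z))\<^sup>2) * P' z)"
  have "Q \<in> polys_lt (Suc (length (i # L)))"
  proof -
    have "(\<lambda>z. (- 2 * b) * (fst z $ i * P z)) \<in> polys_lt (Suc (length (i # L)))"
      using polys_lt_mult[OF polys_lt_coord P, of i] by (intro polys_lt_cmult) simp
    moreover have "(\<lambda>z. ((snd z)\<^sup>2 - (norm (fst z))\<^sup>2) * P' z) \<in> polys_lt (Suc (length (i # L)))"
    \<comment> \<open>For empty \<open>L\<close> the bound on \<open>P'\<close> is
      \<open>polys_lt 0\<close>, which holds only zero; otherwise it has the \<open>Suc\<close> form
      that the product rule for degrees requires.\<close>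
    proof (cases L)
      case Nil
      then have "P' = (\<lambda>z. 0)"
        using P' by (simp add: polys_lt_def zero_fun_def)
      then show ?thesis by simp
    next
      case (Cons l L')
      then show ?thesis using polys_lt_mult[OF polys_lt_cone_form, of P' "length L'"] P' by simp
    qed
    ultimately show ?thesis
      unfolding Q_def using polys_lt_add by (fastforce simp: mult.assoc)
  qed
  moreover have "foldr partial_deriv (i # L) (\<lambda>y. (t\<^sup>2 - (norm y)\<^sup>2) powr a) x
        = (t\<^sup>2 - (norm x)\<^sup>2) powr (b - 1) * Q (x, t)" if "norm x < t" for x t
    using partial_deriv_cone_form_powr[of t "foldr partial_deriv L (\<lambda>y. (t\<^sup>2 - (norm y)\<^sup>2) powr a)" b P i P' x]
      foldr deriv that by (simp add: Q_def)
  moreover have "\<exists>A. (\<forall>t>0. (LINT x|lborel. ball_weight t (b - 1) x * (Q (x, t) * monomial_fun j 0 (x, 0)))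
              = A * t powr (2 * a - length (i # L) + multi_abs j + real CARD('d))) \<and>
        (A \<noteq> 0 \<longrightarrow> (\<forall>l. count_list (i # L) l \<le> j $ l)) \<and>
        ((\<forall>l. count_list (i # L) l = j $ l) \<longrightarrow> A \<noteq> 0)" for j
  proof -
    \<comment> \<open>If \<open>j $ i = 0\<close>, then \<open>j' = j\<close> by truncation; the new
      constant is \<open>- real (j $ i) * A\<close>, so this case contributes zero.\<close>
    define j' where "j' = j - axis i 1"
    obtain A where A: "\<And>t. t > 0 \<Longrightarrow> (LINT x|lborel. ball_weight t b x * (P (x, t) * monomial_fun j' 0 (x, 0)))
              = A * t powr (2 * a - length L + multi_abs j' + real CARD('d))"
      and A1: "A \<noteq> 0 \<longrightarrow> (\<forall>i. count_list L i \<le> j' $ i)"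
      and A2: "(\<forall>i. count_list L i = j' $ i) \<longrightarrow> A \<noteq> 0"
      using integral[of j'] by auto
    have j': "j' $ l = (if l = i then j $ l - 1 else j $ l)" for l
      by (auto simp: j'_def axis_def)
    have main: "(LINT x|lborel. ball_weight t (b - 1) x * (Q (x, t) * monomial_fun j 0 (x, 0)))
        = - real (j $ i) * A * t powr (2 * a - length (i # L) + multi_abs j + real CARD('d))" if t: "t > 0" for t
    proof -
      let ?M = "\<lambda>j x. monomial_fun j 0 (x :: real ^ 'd, 0 :: real)"
      have cont: "continuous_on S (\<lambda>x. P (x, t))" "continuous_on S (\<lambda>x. P' (x, t))"
        "continuous_on S (?M k)" "continuous_on S (\<lambda>x. Q (x, t))" for S k
        using P P' \<open>Q \<in> _\<close> monomial_fun_in_polys_lt[OF lessI] by (auto intro: polys_lt_slice_continuous)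
      have prod: "((\<lambda>s. P (x + s *\<^sub>R axis i 1, t) * ?M j (x + s *\<^sub>R axis i 1)) has_real_derivative
          P' (x + s *\<^sub>R axis i 1, t) * ?M j (x + s *\<^sub>R axis i 1)
          + real (j $ i) * ?M j' (x + s *\<^sub>R axis i 1) * P (x + s *\<^sub>R axis i 1, t)) (at s)" for x s
        unfolding j'_def by (intro DERIV_mult deriv monomial_fun_partial)
      have w: "ball_weight t (b - 1) x * (t\<^sup>2 - (norm x)\<^sup>2) = ball_weight t b x" for x :: "real ^ 'd"
        using power_strict_mono[of "norm x" t 2]
        by (auto simp: ball_weight_def powr_diff indicator_def)
      have "0 = (LINT x|lborel. ball_weight t (b - 1) x *
        (- 2 * b * (x \<bullet> axis i 1) * (P (x, t) * ?M j x) + (t\<^sup>2 - (norm x)\<^sup>2) *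
          (P' (x, t) * ?M j x + real (j $ i) * ?M j' x * P (x, t))))"
        using t b(1) by (intro integral_ball_weight_directional[symmetric] prod continuous_intros cont)
          (auto simp: axis_eq_0_iff)
      also have "\<dots> = (LINT x|lborel. ball_weight t (b - 1) x * (Q (x, t) * ?M j x)
          + real (j $ i) * (ball_weight t b x * (P (x, t) * ?M j' x)))"
        by (intro Bochner_Integration.integral_cong refl)
          (simp add: Q_def inner_axis w[symmetric] algebra_simps)
      also have "\<dots> = (LINT x|lborel. ball_weight t (b - 1) x * (Q (x, t) * ?M j x))
          + real (j $ i) * (LINT x|lborel. ball_weight t b x * (P (x, t) * ?M j' x))"
        using t b(1)
        by (subst Bochner_Integration.integral_add)
          (auto intro!: integrable_ball_weight_mult continuous_intros cont integrable_mult_right)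
      finally have "(LINT x|lborel. ball_weight t (b - 1) x * (Q (x, t) * ?M j x))
        = - real (j $ i) * (LINT x|lborel. ball_weight t b x * (P (x, t) * ?M j' x))"
        by simp
      \<comment> \<open>Passing from \<open>L\<close> to \<open>i # L\<close> lowers the exponent by
        one, and passing from \<open>j'\<close> to \<open>j\<close> raises it by one.\<close>
      moreover have "2 * a - length L + multi_abs j' + real CARD('d)
          = 2 * a - length (i # L) + multi_abs j + real CARD('d)" if "j $ i > 0"
        using multi_abs_diff_axis[OF that] by (simp add: j'_def)
      ultimately show ?thesis
        using A[OF t] by (cases "j $ i = 0") auto
    qed
    have "count_list (i # L) l \<le> j $ l" if "- real (j $ i) * A \<noteq> 0" for l
      using that A1 j'[of l] by (auto dest!: spec[of _ l] split: if_splits)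
    moreover have "- real (j $ i) * A \<noteq> 0" if "\<forall>l. count_list (i # L) l = j $ l"
    proof -
      have "j $ i > 0" using that[rule_format, of i] by simp
      moreover have "count_list L l = j' $ l" for l
        using that[rule_format, of l] j'[of l] by (auto split: if_splits)
      ultimately show ?thesis using A2 by simp
    qed
    ultimately show ?thesis using main by blast
  qed
  ultimately show ?case unfolding b(2) by blast
qed

section \<open>The Rodrigues formula on the unit interval\<close>

lemma lborel_integral_eq_has_integral:
  fixes f :: "'a::euclidean_space \<Rightarrow> real"
  assumes "integrable lborel (\<lambda>x. indicator S x * f x)" "(f has_integral I) S"
  shows "(LINT x|lborel. indicator S x * f x) = I"
  using set_borel_integral_eq_integral(2)[of S f] integral_unique[OF assms(2)] assms(1)
  by (simp add: set_integrable_def set_lebesgue_integral_def)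

definition beta_weight :: "real \<Rightarrow> real \<Rightarrow> real \<Rightarrow> real"
  where "beta_weight a b t = indicator {0<..<1} t * (t powr a * (1 - t) powr b)"

lemma beta_weight_nonneg: "beta_weight a b t \<ge> 0"
  by (simp add: beta_weight_def)

lemma beta_weight_measurable [measurable]: "beta_weight a b \<in> borel_measurable borel"
  unfolding beta_weight_def by measurable

lemma beta_weight_powr: "beta_weight a b t * t powr c = beta_weight (a + c) b t"
  by (auto simp: beta_weight_def powr_add)

lemma integrable_beta_weight:
  assumes "a > - 1" "b > - 1"
  shows "integrable lborel (beta_weight a b)"
proof -
  have "set_integrable lborel {0..1} (\<lambda>t. t powr (a + 1 - 1) * (1 - t) powr (b + 1 - 1))"
    using assms by (intro integrable_Beta) auto
  then have "set_integrable lborel {0<..<1} (\<lambda>t. t powr (a + 1 - 1) * (1 - t) powr (b + 1 - 1))"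
    by (rule set_integrable_subset) auto
  then show ?thesis by (simp add: set_integrable_def beta_weight_def[abs_def])
qed

lemma integral_beta_weight:
  assumes "a > - 1" "b > - 1"
  shows "(LINT t|lborel. beta_weight a b t) = Beta (a + 1) (b + 1)"
proof -
  have "((\<lambda>t. t powr a * (1 - t) powr b) has_integral Beta (a + 1) (b + 1)) {0<..<1}"
    using has_integral_Beta_real[of "a + 1" "b + 1"] assms by (simp add: has_integral_Icc_iff_Ioo)
  with integrable_beta_weight[OF assms] show ?thesis
    unfolding beta_weight_def by (rule lborel_integral_eq_has_integral)
qed

lemma integrable_beta_weight_poly:
  assumes "a > - 1" "b > - 1"
  shows "integrable lborel (\<lambda>t. beta_weight a b t * poly q t)"
proof -
  have "bounded (poly q ` {0..1})"
    by (intro compact_imp_bounded compact_continuous_image continuous_intros) auto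
  then obtain M where M: "\<And>t. 0 \<le> t \<Longrightarrow> t \<le> 1 \<Longrightarrow> \<bar>poly q t\<bar> \<le> M"
    by (force simp: bounded_iff)
  have [measurable]: "poly q \<in> borel_measurable borel"
    by (intro borel_measurable_continuous_onI continuous_intros)
  show ?thesis
  proof (rule Bochner_Integration.integrable_bound)
    show "integrable lborel (\<lambda>t. M * beta_weight a b t)"
      using integrable_beta_weight[OF assms] by simp
    have "norm (beta_weight a b t * poly q t) \<le> norm (M * beta_weight a b t)" for t
    proof (cases "t \<in> {0<..<1}")
      case True
      then have "\<bar>poly q t\<bar> \<le> \<bar>M\<bar>" using M[of t] by simp
      then show ?thesis by (simp add: abs_mult mult.commute mult_right_mono)
    qed (simp add: beta_weight_def)
    then show "AE t in lborel. norm (beta_weight a b t * poly q t) \<le> norm (M * beta_weight a b t)"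
      by simp
  qed simp
qed

text \<open>The polynomial left when \<open>t powr a * (1 - t) powr b * poly q t\<close> is
  differentiated and \<open>t powr (a - 1) * (1 - t) powr (b - 1)\<close> is factored out; iterating
  it from 1 produces Jacobi polynomials on [0, 1].\<close>

definition beta_step :: "real \<Rightarrow> real \<Rightarrow> real poly \<Rightarrow> real poly"
  where "beta_step a b q = smult a ([:1, -1:] * q) - smult b ([:0, 1:] * q) + [:0, 1, -1:] * pderiv q"

lemma poly_beta_step:
  "poly (beta_step a b q) t =
    a * (1 - t) * poly q t - b * t * poly q t + t * (1 - t) * poly (pderiv q) t"
  by (simp add: beta_step_def algebra_simps)

lemma degree_beta_step: "degree (beta_step a b q) \<le> Suc (degree q)"
proof -
  have *: "degree ([:c, e:] * q) \<le> Suc (degree q)" for c e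
    using degree_mult_le[of "[:c, e:]" q] by (simp split: if_splits)
  have "degree ([:0, 1, -1:] * pderiv q) \<le> Suc (degree q)"
  proof (cases "degree q = 0")
    case True
    then have "pderiv q = 0" by (simp add: pderiv_eq_0_iff)
    then show ?thesis by simp
  next
    case False
    then show ?thesis using degree_mult_le[of "[:0, 1, -1:]" "pderiv q"] by (simp add: degree_pderiv)
  qed
  then show ?thesis
    unfolding beta_step_def using * degree_smult_le order_trans
    by (intro degree_add_le degree_diff_le) blast+
qed

lemma DERIV_beta_weight_poly:
  assumes "0 < t" "t < 1"
  shows "((\<lambda>s. s powr a * (1 - s) powr b * poly q s) has_real_derivative
    t powr (a - 1) * (1 - t) powr (b - 1) * poly (beta_step a b q) t) (at t)"
proof -
  have "((\<lambda>s. s powr a) has_real_derivative a * t powr (a - 1) * 1) (at t)"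
    using DERIV_fun_powr[OF DERIV_ident assms(1), of a] by simp
  moreover have "((\<lambda>s. (1 - s) powr b) has_real_derivative b * (1 - t) powr (b - 1) * (- 1)) (at t)"
    using DERIV_fun_powr[of "\<lambda>s. 1 - s" "- 1" t b] assms
    by (auto intro!: derivative_eq_intros)
  ultimately have "((\<lambda>s. s powr a * (1 - s) powr b * poly q s) has_real_derivative
    (a * t powr (a - 1) * 1 * (1 - t) powr b + b * (1 - t) powr (b - 1) * (- 1) * t powr a) * poly q t
      + poly (pderiv q) t * (t powr a * (1 - t) powr b)) (at t)"
    by (intro DERIV_mult poly_DERIV)
  moreover have eqs: "t powr a = t powr (a - 1) * t" "(1 - t) powr b = (1 - t) powr (b - 1) * (1 - t)"
    using assms by (simp_all add: powr_diff)
  have "(a * t powr (a - 1) * 1 * (1 - t) powr b + b * (1 - t) powr (b - 1) * (- 1) * t powr a) * poly q t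
      + poly (pderiv q) t * (t powr a * (1 - t) powr b)
    = t powr (a - 1) * (1 - t) powr (b - 1) * poly (beta_step a b q) t"
    unfolding eqs poly_beta_step by (simp add: algebra_simps)
  ultimately show ?thesis by (simp only:)
qed

text \<open>Integration by parts without boundary terms: for positive \<open>a\<close> and
  \<open>b\<close> the antiderivative vanishes at 0 and at 1.\<close>

lemma integral_beta_step:
  assumes "a > 0" "b > 0"
  shows "(LINT t|lborel. beta_weight (a - 1) (b - 1) t * poly (beta_step a b q) t) = 0"
proof -
  let ?f = "\<lambda>t. t powr (a - 1) * (1 - t) powr (b - 1) * poly (beta_step a b q) t"
  have "(?f has_integral (1 powr a * (1 - 1) powr b * poly q 1 - 0 powr a * (1 - 0) powr b * poly q 0)) {0..1}"
  proof (rule fundamental_theorem_of_calculus_interior)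
    show "continuous_on {0..1} (\<lambda>s. s powr a * (1 - s) powr b * poly q s)"
      using assms by (intro continuous_intros continuous_on_powr') auto
  qed (auto intro!: DERIV_beta_weight_poly simp flip: has_real_derivative_iff_has_vector_derivative)
  then have "(?f has_integral 0) {0<..<1}"
    using assms by (simp add: has_integral_Icc_iff_Ioo)
  moreover have "integrable lborel (\<lambda>t. indicator {0<..<1} t * ?f t)"
    using integrable_beta_weight_poly[of "a - 1" "b - 1" "beta_step a b q"] assms
    by (simp add: beta_weight_def mult.assoc)
  ultimately show ?thesis
    using lborel_integral_eq_has_integral[of "{0<..<1}" ?f 0] by (simp add: beta_weight_def mult.assoc)
qed

text \<open>The one-dimensional counterpart of \<open>ball_rodrigues\<close>. Moving
  \<open>m\<close> derivatives onto \<open>t ^ s\<close> kills it for \<open>s < m\<close>; for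
  \<open>s = m\<close> it leaves a factorial, up to sign, times a Beta value.\<close>

lemma beta_rodrigues:
  assumes "a > real m - 1" "b > real m - 1"
  shows "\<exists>q. degree q \<le> m \<and>
    (\<forall>t. 0 < t \<longrightarrow> t < 1 \<longrightarrow>
      (deriv ^^ m) (\<lambda>s. s powr a * (1 - s) powr b) t = t powr (a - m) * (1 - t) powr (b - m) * poly q t) \<and>
    (\<forall>s<m. (LINT t|lborel. beta_weight (a - m) (b - m) t * (poly q t * t ^ s)) = 0) \<and>
    (LINT t|lborel. beta_weight (a - m) (b - m) t * (poly q t * t ^ m)) \<noteq> 0"
  using assms
proof (induction m)
  case 0
  then have "Beta (a + 1) (b + 1) > 0"
    by (simp add: Beta_def Gamma_real_pos)
  then show ?case
    using 0 by (intro exI[of _ 1]) (auto simp: integral_beta_weight)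
next
  case (Suc m)
  define a' b' where "a' = a - m" "b' = b - m"
  have ab': "a' > 0" "b' > 0" "a - Suc m = a' - 1" "b - Suc m = b' - 1"
    using Suc.prems by (auto simp: a'_b'_def)
  from Suc obtain q where deg: "degree q \<le> m"
    and deriv: "\<And>t. 0 < t \<Longrightarrow> t < 1 \<Longrightarrow>
      (deriv ^^ m) (\<lambda>s. s powr a * (1 - s) powr b) t = t powr a' * (1 - t) powr b' * poly q t"
    and zero: "\<And>s. s < m \<Longrightarrow> (LINT t|lborel. beta_weight a' b' t * (poly q t * t ^ s)) = 0"
    and nz: "(LINT t|lborel. beta_weight a' b' t * (poly q t * t ^ m)) \<noteq> 0"
    unfolding a'_b'_def by auto
  define r where "r = beta_step a' b' q"
  have "degree r \<le> Suc m"
    using degree_beta_step[of a' b' q] deg by (simp add: r_def)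
  moreover have "(deriv ^^ Suc m) (\<lambda>s. s powr a * (1 - s) powr b) t
      = t powr (a' - 1) * (1 - t) powr (b' - 1) * poly r t" if t: "0 < t" "t < 1" for t
  proof -
    have "((deriv ^^ m) (\<lambda>s. s powr a * (1 - s) powr b) has_real_derivative
      t powr (a' - 1) * (1 - t) powr (b' - 1) * poly r t) (at t)"
      unfolding r_def
      by (rule has_field_derivative_transform_within_open[OF DERIV_beta_weight_poly open_greaterThanLessThan[of 0 1]])
        (use t deriv in auto)
    then show ?thesis by (simp add: DERIV_imp_deriv)
  qed
  moreover have main: "(LINT t|lborel. beta_weight (a' - 1) (b' - 1) t * (poly r t * t ^ s))
      = - real s * (LINT t|lborel. beta_weight a' b' t * (poly q t * t ^ (s - 1)))" for s
  proof -
    \<comment> \<open>Applying \<open>beta_step\<close> to \<open>q * monom 1 s\<close> instead of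
      \<open>q\<close> lets the product rule split the vanishing integral into the two that are
      compared. The truncated \<open>s - 1\<close> is harmless at \<open>s = 0\<close>, where its
      factor is zero.\<close>
    have step: "beta_weight (a' - 1) (b' - 1) t * poly (beta_step a' b' (q * monom 1 s)) t
      = beta_weight (a' - 1) (b' - 1) t * (poly r t * t ^ s)
        + real s * (beta_weight a' b' t * (poly q t * t ^ (s - 1)))" for t
    proof (cases "t \<in> {0<..<1}")
      case True
      then have eqs: "t powr a' = t powr (a' - 1) * t" "(1 - t) powr b' = (1 - t) powr (b' - 1) * (1 - t)"
        by (simp_all add: powr_diff)
      show ?thesis
        unfolding beta_weight_def poly_beta_step r_def eqs
        using True by (simp add: pderiv_mult pderiv_monom poly_monom algebra_simps)
    qed (simp add: beta_weight_def)
    have "integrable lborel (\<lambda>t. beta_weight (a' - 1) (b' - 1) t * (poly r t * t ^ s))"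
      using integrable_beta_weight_poly[of "a' - 1" "b' - 1" "r * monom 1 s"] ab'
      by (simp add: poly_monom)
    moreover have "integrable lborel (\<lambda>t. beta_weight a' b' t * (poly q t * t ^ (s - 1)))"
      using integrable_beta_weight_poly[of a' b' "q * monom 1 (s - 1)"] ab'
      by (simp add: poly_monom)
    ultimately show ?thesis
      using integral_beta_step[of a' b' "q * monom 1 s"] ab' unfolding step by simp
  qed
  moreover have "(LINT t|lborel. beta_weight (a' - 1) (b' - 1) t * (poly r t * t ^ s)) = 0" if "s < Suc m" for s
    unfolding main using zero[of "s - 1"] that by (cases s) auto
  moreover have "(LINT t|lborel. beta_weight (a' - 1) (b' - 1) t * (poly r t * t ^ Suc m)) \<noteq> 0"
    unfolding main using nz by simp
  ultimately show ?case unfolding ab'(3,4) by blast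
qed

section \<open>The inner product on the cone\<close>

text \<open>An identity at every point, boundary included: where \<open>norm x = t\<close> or
  \<open>t = 1\<close>, one of the powers has base 0 and is therefore 0, whatever its
  exponent.\<close>

lemma cone_weight_indicator:
  "indicator solid_cone z * cone_weight \<beta> \<gamma> \<mu> z =
    ball_weight (snd z) (\<mu> - 1/2) (fst z) * beta_weight \<beta> \<gamma> (snd z)"
proof -
  obtain x t where z: "z = (x, t)" by (cases z)
  consider "norm x < t" "t < 1" | "norm x = t" | "t \<ge> 1" | "norm x > t" by linarith
  then show ?thesis
  proof cases
    case 1
    then have "0 < t" using norm_ge_zero[of x] by linarith
    with 1 show ?thesis
      by (simp add: z solid_cone_def cone_weight_def ball_weight_def beta_weight_def)
  qed (auto simp: z solid_cone_def cone_weight_def ball_weight_def beta_weight_def)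
qed

lemma cone_inner_eq:
  "cone_inner \<beta> \<gamma> \<mu> f g = (LINT z|lborel.
    (ball_weight (snd z) (\<mu> - 1/2) (fst z) * beta_weight \<beta> \<gamma> (snd z)) * (f z * g z))"
  unfolding cone_inner_def set_lebesgue_integral_def cone_weight_indicator[symmetric]
  by (simp add: mult_ac)

text \<open>\<open>ty\<close> fixes the dimension, since \<open>'d\<close> occurs in no other
  parameter.\<close>

locale cone_parameters =
  fixes \<mu> \<beta> \<gamma> :: real and ty :: "'d::{finite,linorder} itself"
  assumes \<mu>: "\<mu> > - 1/2" and \<gamma>: "\<gamma> > - 1" and \<beta>: "2 * \<mu> + \<beta> + real CARD('d) > 0"
begin

definition weight :: "(real ^ 'd::{finite,linorder}) \<times> real \<Rightarrow> real"
  where "weight z = ball_weight (snd z) (\<mu> - 1/2) (fst z) * beta_weight \<beta> \<gamma> (snd z)"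

lemma weight_nonneg: "weight z \<ge> 0"
  by (simp add: weight_def ball_weight_nonneg beta_weight_nonneg)

lemma weight_measurable [measurable]: "weight \<in> borel_measurable borel"
  unfolding weight_def borel_prod[symmetric] by measurable

lemma weight_pos_iff: "weight (x, t) > 0 \<longleftrightarrow> norm x < t \<and> t < 1"
proof -
  have "t > 0 \<Longrightarrow> norm x < t \<Longrightarrow> t\<^sup>2 - (norm x)\<^sup>2 > 0"
    using cone_form_pos_iff[of t x] by blast
  moreover have "norm x < t \<Longrightarrow> t > 0" using norm_ge_zero[of x] by linarith
  ultimately show ?thesis
    by (auto simp: weight_def ball_weight_def beta_weight_def indicator_def zero_less_mult_iff)
qed

text \<open>Tonelli with \<open>x\<close> innermost. By homogeneity the slice contributes
  \<open>t powr e\<close> with \<open>e = 2 * \<mu> + d - 1\<close>, and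
  \<open>\<beta> + e > -1\<close> even when \<open>\<beta>\<close> itself is smaller than
  -1.\<close>

lemma integrable_weight: "integrable lborel weight"
proof (rule integrableI_bounded)
  define N where "N = (\<integral>\<^sup>+x. ball_weight 1 (\<mu> - 1/2) (x :: real ^ 'd::{finite,linorder}) \<partial>lborel)"
  define e where "e = 2 * (\<mu> - 1/2) + real CARD('d)"
  have N: "N < \<infinity>" unfolding N_def using \<mu> by (intro nn_integral_ball_weight_finite) simp
  have "(\<integral>\<^sup>+z. ennreal (norm (weight z)) \<partial>lborel) = (\<integral>\<^sup>+z. ennreal (weight z) \<partial>(lborel \<Otimes>\<^sub>M lborel))"
    by (simp add: weight_nonneg lborel_prod)
  also have "\<dots> = (\<integral>\<^sup>+t. \<integral>\<^sup>+x. ennreal (weight (x, t)) \<partial>lborel \<partial>lborel)"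
    by (rule lborel_pair.nn_integral_snd[symmetric]) (simp add: lborel_prod)
  also have "\<dots> = (\<integral>\<^sup>+t. ennreal (beta_weight (\<beta> + e) \<gamma> t) * N \<partial>lborel)"
  proof (rule nn_integral_cong)
    fix t :: real
    have "(\<integral>\<^sup>+x. ennreal (weight (x, t)) \<partial>lborel) =
      ennreal (beta_weight \<beta> \<gamma> t) * (\<integral>\<^sup>+x. ball_weight t (\<mu> - 1/2) (x :: real ^ 'd::{finite,linorder}) \<partial>lborel)"
      by (simp add: weight_def mult.commute[of "ball_weight _ _ _"] ennreal_mult' beta_weight_nonneg
          nn_integral_cmult)
    also have "\<dots> = ennreal (beta_weight (\<beta> + e) \<gamma> t) * N"
    proof (cases "t > 0")
      case True
      then have "(\<integral>\<^sup>+x. ball_weight t (\<mu> - 1/2) (x :: real ^ 'd::{finite,linorder}) \<partial>lborel) = ennreal (t powr e) * N"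
        using nn_integral_ball_weight[of t "\<mu> - 1/2", where 'a = "real ^ 'd::{finite,linorder}"]
        by (simp add: N_def e_def)
      moreover have "ennreal (beta_weight \<beta> \<gamma> t) * ennreal (t powr e) = ennreal (beta_weight (\<beta> + e) \<gamma> t)"
        by (simp only: ennreal_mult'[OF beta_weight_nonneg, symmetric] beta_weight_powr)
      ultimately show ?thesis by (simp only: mult.assoc[symmetric])
    qed (simp add: beta_weight_def)
    finally show "(\<integral>\<^sup>+x. ennreal (weight (x, t)) \<partial>lborel) = ennreal (beta_weight (\<beta> + e) \<gamma> t) * N" .
  qed
  also have "\<dots> = (\<integral>\<^sup>+t. ennreal (beta_weight (\<beta> + e) \<gamma> t) \<partial>lborel) * N"
    by (simp add: nn_integral_multc)
  also have "\<dots> < \<infinity>"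
    using N integrable_beta_weight[of "\<beta> + e" \<gamma>] \<gamma> \<beta>
    by (simp add: e_def integrable_iff_bounded beta_weight_nonneg ennreal_mult_less_top)
  finally show "(\<integral>\<^sup>+z. ennreal (norm (weight z)) \<partial>lborel) < \<infinity>" .
qed simp

lemma integrable_weight_poly:
  assumes p: "p \<in> polys_lt n"
  shows "integrable lborel (\<lambda>z. weight z * p z)"
proof -
  have "bounded (p ` (cball 0 1 \<times> {0..1}))"
    by (intro compact_imp_bounded compact_continuous_image continuous_on_polys_lt[OF p] compact_Times) auto
  then obtain M where M: "\<And>x t. norm x \<le> 1 \<Longrightarrow> 0 \<le> t \<Longrightarrow> t \<le> 1 \<Longrightarrow> \<bar>p (x, t)\<bar> \<le> M"
    by (force simp: bounded_iff)
  have [measurable]: "p \<in> borel_measurable borel"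
    by (intro borel_measurable_continuous_onI continuous_on_polys_lt[OF p])
  show ?thesis
  proof (rule Bochner_Integration.integrable_bound)
    show "integrable lborel (\<lambda>z. M * weight z)"
      using integrable_weight by simp
    have "norm (weight z * p z) \<le> norm (M * weight z)" for z
    proof (cases "weight z > 0")
      case True
      obtain x t where z: "z = (x, t)" by (cases z)
      have "norm x < t" "t < 1" using True by (simp_all add: z weight_pos_iff)
      then have "\<bar>p z\<bar> \<le> \<bar>M\<bar>"
        using M[of x t] norm_ge_zero[of x] unfolding z by linarith
      then show ?thesis by (simp add: abs_mult mult.commute mult_right_mono)
    qed (use weight_nonneg[of z] in simp)
    then show "AE z in lborel. norm (weight z * p z) \<le> norm (M * weight z)"
      by simp
  qed simp
qed

abbreviation inner_prod where "inner_prod \<equiv> cone_inner \<beta> \<gamma> \<mu> :: ((real ^ 'd::{finite,linorder}) \<times> real \<Rightarrow> real) \<Rightarrow> _"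

lemma inner_prod_eq: "inner_prod f g = (LINT z|lborel. weight z * (f z * g z))"
  by (simp add: cone_inner_eq weight_def)

lemma integrable_weight_mult:
  assumes "f \<in> polys_lt m" "g \<in> polys_lt n"
  shows "integrable lborel (\<lambda>z. weight z * (f z * g z))"
proof -
  have "f \<in> polys_lt (Suc m)" "g \<in> polys_lt (Suc n)"
    using assms polys_lt_mono[of m "Suc m"] polys_lt_mono[of n "Suc n"] by auto
  from integrable_weight_poly[OF polys_lt_mult[OF this]] show ?thesis .
qed

lemma inner_prod_add_left:
  assumes "f \<in> polys_lt m" "g \<in> polys_lt m" "h \<in> polys_lt n"
  shows "inner_prod (\<lambda>z. f z + g z) h = inner_prod f h + inner_prod g h"
proof -
  have "integrable lborel (\<lambda>z. weight z * (f z * h z))" "integrable lborel (\<lambda>z. weight z * (g z * h z))"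
    using assms by (auto intro: integrable_weight_mult)
  then show ?thesis
    unfolding inner_prod_eq distrib_left distrib_right by (rule Bochner_Integration.integral_add)
qed

lemma inner_prod_commute: "inner_prod f g = inner_prod g f"
  by (simp add: inner_prod_eq mult.commute)

lemma inner_prod_cmult_left: "inner_prod (\<lambda>z. c * f z) h = c * inner_prod f h"
  unfolding inner_prod_eq by (simp add: mult_ac flip: Bochner_Integration.integral_mult_right_zero)

text \<open>The weight is positive in the interior of the cone, so \<open>p\<close> vanishes almost
  everywhere there. The points of the interior with \<open>p z \<noteq> 0\<close> form an open null
  set, which is empty, and the identity principle concludes.\<close>

lemma inner_prod_definite:
  assumes p: "p \<in> polys_lt n" and zero: "inner_prod p p = 0"
  shows "p = (\<lambda>z. 0)"
proof -
  define S where "S = {z :: (real ^ 'd::{finite,linorder}) \<times> real. norm (fst z) < snd z \<and> snd z < 1}"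
  have S: "open S" "(0, 1/2) \<in> S"
    unfolding S_def by (auto intro!: open_Collect_conj open_Collect_less continuous_intros)
  have "AE z in lborel. weight z * (p z * p z) = 0"
    using integral_nonneg_eq_0_iff_AE[OF integrable_weight_mult[OF p p]] zero
    by (simp add: inner_prod_eq weight_nonneg)
  then have "AE z in lborel. z \<notin> S \<inter> {z. p z \<noteq> 0}"
  proof eventually_elim
    case (elim z)
    then show ?case using weight_pos_iff[of "fst z" "snd z"] by (auto simp: S_def)
  qed
  moreover have op: "open (S \<inter> {z. p z \<noteq> 0})"
    using S continuous_on_polys_lt[OF p] by (intro open_Int open_Collect_neq continuous_intros) auto
  ultimately have "negligible (S \<inter> {z. p z \<noteq> 0})"
    using AE_iff_null_sets[of "S \<inter> {z. p z \<noteq> 0}" lborel]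
    by (simp add: negligible_iff_null_sets null_sets_completionI)
  then have "S \<inter> {z. p z \<noteq> 0} = {}" using open_not_negligible[OF op] by blast
  then show ?thesis using polys_lt_eq_zero[OF p S] by blast
qed

lemma inner_prod_sum_left:
  assumes "\<And>k. k \<in> K \<Longrightarrow> f k \<in> polys_lt m" "h \<in> polys_lt n"
  shows "inner_prod (\<lambda>z. \<Sum>k\<in>K. c k * f k z) h = (\<Sum>k\<in>K. c k * inner_prod (f k) h)"
  using assms(1)
proof (induction K rule: infinite_finite_induct)
  case (insert k K)
  then show ?case
    using inner_prod_add_left[of "\<lambda>z. c k * f k z" m "\<lambda>z. \<Sum>k\<in>K. c k * f k z" h n] assms(2)
    by (simp add: inner_prod_cmult_left polys_lt_sum polys_lt_cmult)
qed (simp_all add: inner_prod_eq)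

end

section \<open>Interior of the cone and iterated partial derivatives\<close>

lemma interior_solid_cone:
  "interior (solid_cone :: ((real ^ 'd::finite) \<times> real) set) = {z. norm (fst z) < snd z \<and> snd z < 1}"
proof
  have "open {z :: (real ^ 'd) \<times> real. norm (fst z) < snd z \<and> snd z < 1}"
    by (intro open_Collect_conj open_Collect_less continuous_intros)
  moreover have "{z :: (real ^ 'd) \<times> real. norm (fst z) < snd z \<and> snd z < 1} \<subseteq> solid_cone"
    by (auto simp: solid_cone_def intro: less_imp_le[OF le_less_trans[OF norm_ge_zero]])
  ultimately show "{z :: (real ^ 'd) \<times> real. norm (fst z) < snd z \<and> snd z < 1} \<subseteq> interior solid_cone"
    by (rule interior_maximal[rotated])
  show "interior solid_cone \<subseteq> {z :: (real ^ 'd) \<times> real. norm (fst z) < snd z \<and> snd z < 1}"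
  proof
    fix z :: "(real ^ 'd) \<times> real"
    assume "z \<in> interior solid_cone"
    then obtain e where e: "e > 0" "cball z e \<subseteq> solid_cone"
      by (auto simp: mem_interior_cball)
    \<comment> \<open>Vertical shifts suffice: moving down by \<open>e\<close> gives
      \<open>norm x < t\<close>, moving up by \<open>e\<close> gives \<open>t < 1\<close>.\<close>
    have "(fst z, snd z + s) \<in> solid_cone" if "\<bar>s\<bar> \<le> e" for s
      using that e(2) by (intro subsetD[OF e(2)]) (cases z, auto simp: dist_Pair_Pair dist_norm)
    from this[of e] this[of "- e"] show "z \<in> {z. norm (fst z) < snd z \<and> snd z < 1}"
      using e(1) by (auto simp: solid_cone_def)
  qed
qed

lemma foldr_funpow_eq_foldr_concat:
  "foldr (\<lambda>i. g i ^^ k i) xs = foldr g (concat (map (\<lambda>i. replicate (k i) i) xs))"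
  by (induction xs) (auto simp: foldr_append)

lemma count_list_concat_replicate:
  "distinct xs \<Longrightarrow> count_list (concat (map (\<lambda>i. replicate (k i) i) xs)) i = (if i \<in> set xs then k i else 0)"
proof (induction xs)
  case (Cons x xs)
  have "count_list (replicate n x) i = (if i = x then n else 0)" for n
    by (induction n) auto
  with Cons show ?case by auto
qed simp

text \<open>Brings the nested iterates into the list form on which \<open>ball_rodrigues\<close>
  inducts.\<close>

lemma multi_partial_eq_foldr:
  fixes kv :: "nat ^ 'd::{finite,linorder}"
  obtains L where "\<And>f. multi_partial kv f = foldr partial_deriv L f"
    "length L = multi_abs kv" "\<And>i. count_list L i = kv $ i"
proof
  let ?xs = "sorted_list_of_set (UNIV :: 'd set)"
  let ?L = "concat (map (\<lambda>i. replicate (kv $ i) i) ?xs)"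
  show "multi_partial kv f = foldr partial_deriv ?L f" for f
    unfolding multi_partial_def by (simp add: foldr_funpow_eq_foldr_concat)
  show "length ?L = multi_abs kv"
    by (simp add: length_concat multi_abs_def o_def sum_list_distinct_conv_sum_set)
  show "count_list ?L i = kv $ i" for i
    by (simp add: count_list_concat_replicate)
qed

section \<open>Rodrigues polynomials on the cone and their pairings with monomials\<close>

context cone_parameters
begin

lemma rodrigues_cone_biorthogonal:
  fixes kv :: "nat ^ 'd::{finite,linorder}"
  assumes "multi_abs kv \<le> n"
  obtains u where "u \<in> polys_lt (Suc n)"
    "\<And>z. z \<in> interior solid_cone \<Longrightarrow> u z = rodrigues_cone \<beta> \<gamma> \<mu> n kv z"
    "\<And>j i. multi_abs j + i < n \<Longrightarrow> inner_prod u (monomial_fun j i) = 0"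
    "\<And>j i l. multi_abs j + i = n \<Longrightarrow> inner_prod u (monomial_fun j i) \<noteq> 0 \<Longrightarrow> kv $ l \<le> j $ l"
    "inner_prod u (monomial_fun kv (n - multi_abs kv)) \<noteq> 0"
proof -
  define k where "k = multi_abs kv"
  define m where "m = n - k"
  \<comment> \<open>The requirement \<open>a > k - 1\<close> of \<open>ball_rodrigues\<close> is
    exactly \<open>\<mu> > -1/2\<close>. The number \<open>\<alpha>\<close> is the exponent of
    \<open>t\<close> left after \<open>n - k\<close> derivatives; it exceeds \<open>\<beta>\<close>
    by the exponent of the prefactor \<open>1 / t powr (2 * k + 2 * \<mu> + d - 1)\<close>, so all
    powers of \<open>t\<close> cancel in the Rodrigues expression.\<close>
  define a where "a = real k + \<mu> - 1/2"
  define \<alpha> where "\<alpha> = 2 * real k + 2 * \<mu> + \<beta> + real CARD('d) - 1"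
  have n: "n = k + m" using assms by (simp add: m_def k_def)
  have \<alpha>: "\<alpha> > - 1" using \<beta> by (simp add: \<alpha>_def)
  have ak: "a - real k = \<mu> - 1/2" by (simp add: a_def)
  obtain L where L: "\<And>f. multi_partial kv f = foldr partial_deriv L f"
    "length L = k" "\<And>i. count_list L i = kv $ i"
    unfolding k_def using multi_partial_eq_foldr[of kv] by metis
  have "a > real (length L) - 1" using \<mu> by (simp add: a_def L(2))
  from ball_rodrigues[OF this] obtain P where P: "P \<in> polys_lt (Suc k)"
    and P_deriv: "\<And>t x. norm x < t \<Longrightarrow> multi_partial kv (\<lambda>y. (t\<^sup>2 - (norm y)\<^sup>2) powr a) x
        = (t\<^sup>2 - (norm x)\<^sup>2) powr (\<mu> - 1/2) * P (x, t)"
    and P_int: "\<And>j. \<exists>A. (\<forall>t>0. (LINT x|lborel. ball_weight t (\<mu> - 1/2) x * (P (x, t) * monomial_fun j 0 (x, 0)))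
              = A * t powr (2 * a - k + multi_abs j + real CARD('d))) \<and>
        (A \<noteq> 0 \<longrightarrow> (\<forall>i. kv $ i \<le> j $ i)) \<and>
        ((\<forall>i. kv $ i = j $ i) \<longrightarrow> A \<noteq> 0)"
    unfolding L(2,3) ak by (auto simp: L(1))
  have "\<alpha> + m > real m - 1" "\<gamma> + m > real m - 1" using \<alpha> \<gamma> by auto
  from beta_rodrigues[OF this] obtain q where q: "degree q \<le> m"
    and q_deriv: "\<And>t. 0 < t \<Longrightarrow> t < 1 \<Longrightarrow>
      (deriv ^^ m) (\<lambda>s. s powr (\<alpha> + m) * (1 - s) powr (\<gamma> + m)) t = t powr \<alpha> * (1 - t) powr \<gamma> * poly q t"
    and q_zero: "\<And>s. s < m \<Longrightarrow> (LINT t|lborel. beta_weight \<alpha> \<gamma> t * (poly q t * t ^ s)) = 0"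
    and q_nz: "(LINT t|lborel. beta_weight \<alpha> \<gamma> t * (poly q t * t ^ m)) \<noteq> 0"
    by auto
  define u where "u = (\<lambda>z. P z * poly q (snd z))"
  have u: "u \<in> polys_lt (Suc n)"
    unfolding u_def n by (intro polys_lt_mult P polys_lt_poly q)
  have u_rodrigues: "u z = rodrigues_cone \<beta> \<gamma> \<mu> n kv z" if "z \<in> interior solid_cone" for z
  proof -
    obtain x t where z: "z = (x, t)" by (cases z)
    have t: "norm x < t" "t < 1" using that by (auto simp: interior_solid_cone z)
    then have "t > 0" using norm_ge_zero[of x] by linarith
    have w: "t\<^sup>2 - (norm x)\<^sup>2 > 0" using cone_form_pos_iff[of t x] \<open>t > 0\<close> t by blast
    have e1: "real n + real k + \<beta> + 2 * \<mu> + real CARD('d) - 1 = \<alpha> + m" "\<gamma> + real n - real k = \<gamma> + m"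
      "n - k = m"
      by (simp_all add: \<alpha>_def n)
    have "rodrigues_cone \<beta> \<gamma> \<mu> n kv z = 1 / ((t\<^sup>2 - (norm x)\<^sup>2) powr (\<mu> - 1/2) * t powr \<beta> * (1 - t) powr \<gamma>)
      * (1 / t powr (2 * real k + 2 * \<mu> + real CARD('d) - 1))
      * ((t\<^sup>2 - (norm x)\<^sup>2) powr (\<mu> - 1/2) * P (x, t)) * (t powr \<alpha> * (1 - t) powr \<gamma> * poly q t)"
      unfolding z rodrigues_cone_def cone_weight_def prod.case Let_def k_def[symmetric] a_def[symmetric]
        e1 P_deriv[OF t(1)] q_deriv[OF \<open>t > 0\<close> t(2)] ..
    also have "t powr \<alpha> = t powr \<beta> * t powr (2 * real k + 2 * \<mu> + real CARD('d) - 1)"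
      by (simp add: \<alpha>_def flip: powr_add) (simp add: algebra_simps)
    also have "1 / ((t\<^sup>2 - (norm x)\<^sup>2) powr (\<mu> - 1/2) * t powr \<beta> * (1 - t) powr \<gamma>)
      * (1 / t powr (2 * real k + 2 * \<mu> + real CARD('d) - 1))
      * ((t\<^sup>2 - (norm x)\<^sup>2) powr (\<mu> - 1/2) * P (x, t)) *
      (t powr \<beta> * t powr (2 * real k + 2 * \<mu> + real CARD('d) - 1) * (1 - t) powr \<gamma> * poly q t)
      = P (x, t) * poly q t"
      using w t \<open>t > 0\<close> by (simp add: divide_simps)
    finally show ?thesis by (simp add: u_def z)
  qed
  \<comment> \<open>The slice integral supplies
    \<open>t powr (\<alpha> - \<beta>) * t ^ (multi_abs j - k)\<close>, turning the weight
    \<open>\<beta>\<close> into \<open>\<alpha>\<close>. The subtraction is exact when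
    \<open>A \<noteq> 0\<close>, because then \<open>kv\<close> lies below \<open>j\<close>; for
    \<open>A = 0\<close> both sides vanish.\<close>
  have pairing: "\<exists>A. (A \<noteq> 0 \<longrightarrow> (\<forall>l. kv $ l \<le> j $ l)) \<and> (kv = j \<longrightarrow> A \<noteq> 0) \<and>
    inner_prod u (monomial_fun j i) =
      A * (LINT t|lborel. beta_weight \<alpha> \<gamma> t * (poly q t * t ^ (i + multi_abs j - k)))" for j i
  proof -
    obtain A where A: "\<And>t. t > 0 \<Longrightarrow> (LINT x|lborel. ball_weight t (\<mu> - 1/2) x * (P (x, t) * monomial_fun j 0 (x, 0)))
              = A * t powr (2 * a - k + multi_abs j + real CARD('d))"
      and A1: "A \<noteq> 0 \<Longrightarrow> \<forall>l. kv $ l \<le> j $ l" and A2: "kv = j \<longrightarrow> A \<noteq> 0"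
      using P_int[of j] by auto
    have mono: "monomial_fun j i (x, t) = monomial_fun j 0 (x, 0) * t ^ i" for x and t :: real
      by (simp add: monomial_fun_def)
    have "integrable (lborel \<Otimes>\<^sub>M lborel) (\<lambda>(x, t). weight (x, t) * (u (x, t) * monomial_fun j i (x, t)))"
      using integrable_weight_mult[OF u monomial_fun_in_polys_lt[OF lessI, of j i]]
      by (simp add: lborel_prod case_prod_unfold)
    from lborel_pair.integral_snd[OF this]
    have "inner_prod u (monomial_fun j i)
      = (LINT t|lborel. LINT x|lborel. weight (x, t) * (u (x, t) * monomial_fun j i (x, t)))"
      by (simp add: inner_prod_eq lborel_prod case_prod_unfold)
    also have "\<dots> = (LINT t|lborel. A * (beta_weight \<alpha> \<gamma> t * (poly q t * t ^ (i + multi_abs j - k))))"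
    proof (rule Bochner_Integration.integral_cong)
      fix t :: real
      show "(LINT x|lborel. weight (x, t) * (u (x, t) * monomial_fun j i (x, t)))
        = A * (beta_weight \<alpha> \<gamma> t * (poly q t * t ^ (i + multi_abs j - k)))"
      proof (cases "t > 0")
        case True
        have "(LINT x|lborel. weight (x, t) * (u (x, t) * monomial_fun j i (x, t)))
          = (LINT x|lborel. (beta_weight \<beta> \<gamma> t * poly q t * t ^ i) *
              (ball_weight t (\<mu> - 1/2) x * (P (x, t) * monomial_fun j 0 (x, 0))))"
          by (intro Bochner_Integration.integral_cong refl) (simp add: weight_def u_def mono)
        also have "\<dots> = (beta_weight \<beta> \<gamma> t * poly q t * t ^ i) *
            (A * t powr (2 * a - k + multi_abs j + real CARD('d)))"
          using A[OF True] by simp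
        also have "\<dots> = A * (beta_weight \<alpha> \<gamma> t * (poly q t * t ^ (i + multi_abs j - k)))"
        proof (cases "A = 0")
          case False
          then have "k \<le> multi_abs j" unfolding k_def using A1 by (intro multi_abs_mono) blast
          then obtain l where l: "multi_abs j = k + l" using le_Suc_ex by blast
          have "2 * a - k + multi_abs j + real CARD('d) = (\<alpha> - \<beta>) + l"
            by (simp add: a_def \<alpha>_def l)
          then have "t powr (2 * a - k + multi_abs j + real CARD('d)) = t powr (\<alpha> - \<beta>) * t ^ l"
            using True by (simp only: powr_add powr_realpow)
          then have "(beta_weight \<beta> \<gamma> t * poly q t * t ^ i) * (A * t powr (2 * a - k + multi_abs j + real CARD('d)))
            = A * ((beta_weight \<beta> \<gamma> t * t powr (\<alpha> - \<beta>)) * (poly q t * t ^ (i + l)))"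
            by (simp add: power_add)
          then show ?thesis by (simp add: beta_weight_powr l)
        qed simp
        finally show ?thesis .
      next
        case False
        then have "weight (x, t) = 0" "beta_weight \<alpha> \<gamma> t = 0" for x
          by (simp_all add: weight_def beta_weight_def)
        then show ?thesis by simp
      qed
    qed simp
    finally show ?thesis using A1 A2 by (intro exI[of _ A]) simp
  qed
  show ?thesis
  proof (rule that[of u])
    show "inner_prod u (monomial_fun j i) = 0" if "multi_abs j + i < n" for j i
    proof -
      obtain A where A: "A \<noteq> 0 \<longrightarrow> (\<forall>l. kv $ l \<le> j $ l)" "inner_prod u (monomial_fun j i) =
          A * (LINT t|lborel. beta_weight \<alpha> \<gamma> t * (poly q t * t ^ (i + multi_abs j - k)))"
        using pairing[of j i] by blast
      show ?thesis
      proof (cases "A = 0")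
        case False
        then have "k \<le> multi_abs j" unfolding k_def using A(1) by (intro multi_abs_mono) blast
        then have "i + multi_abs j - k < m" using that n by simp
        then show ?thesis using A(2) q_zero by simp
      qed (simp add: A)
    qed
    show "kv $ l \<le> j $ l" if "multi_abs j + i = n" "inner_prod u (monomial_fun j i) \<noteq> 0" for j i l
      using pairing[of j i] that by auto
    show "inner_prod u (monomial_fun kv (n - multi_abs kv)) \<noteq> 0"
      using pairing[of kv "n - multi_abs kv"] q_nz assms by (auto simp: m_def k_def)
  qed (use u u_rodrigues in auto)
qed

lemma UJ_eqI:
  fixes kv :: "nat ^ 'd::{finite,linorder}"
  assumes u: "u \<in> polys_lt m"
    and eq: "\<And>z. z \<in> interior solid_cone \<Longrightarrow> u z = rodrigues_cone \<beta> \<gamma> \<mu> n kv z"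
  shows "UJ \<beta> \<gamma> \<mu> n kv = u"
  unfolding UJ_def
proof (rule the_equality)
  show "u \<in> (\<Union>m. polys_lt m) \<and> (\<forall>z\<in>interior solid_cone. u z = rodrigues_cone \<beta> \<gamma> \<mu> n kv z)"
    using u eq by blast
  fix p
  assume p: "p \<in> (\<Union>m. polys_lt m) \<and> (\<forall>z\<in>interior solid_cone. p z = rodrigues_cone \<beta> \<gamma> \<mu> n kv z)"
  then obtain l where "p \<in> polys_lt l" by blast
  then have "(\<lambda>z. p z - u z) \<in> polys_lt (max l m)"
    using u polys_lt_mono[of l "max l m"] polys_lt_mono[of m "max l m"] by (intro polys_lt_diff) auto
  moreover have "(0, 1/2) \<in> interior (solid_cone :: ((real ^ 'd::{finite,linorder}) \<times> real) set)"
    by (simp add: interior_solid_cone)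
  ultimately have "(\<lambda>z. p z - u z) = (\<lambda>z. 0)"
    using p eq by (intro polys_lt_eq_zero[of _ _ "interior solid_cone"]) auto
  then show "p = u" by (simp add: fun_eq_iff)
qed

end

section \<open>Finiteness of the index set and a dimension count\<close>

lemma finite_multi_abs_le: "finite {k :: nat ^ 'd::finite. multi_abs k \<le> n}"
proof (rule finite_subset)
  show "{k :: nat ^ 'd. multi_abs k \<le> n} \<subseteq> vec_lambda ` (PiE UNIV (\<lambda>_. {..n}))"
  proof
    fix k :: "nat ^ 'd"
    assume "k \<in> {k. multi_abs k \<le> n}"
    then have "k $ i \<le> n" for i
      using member_le_sum[of i UNIV "($) k"] by (simp add: multi_abs_def)
    then show "k \<in> vec_lambda ` (PiE UNIV (\<lambda>_. {..n}))"
      by (intro image_eqI[of _ _ "($) k"]) auto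
  qed
qed (auto intro!: finite_imageI finite_PiE)

lemma finite_monomial_funs:
  "finite {monomial_fun a j :: (real ^ 'd::finite) \<times> real \<Rightarrow> real | a j. multi_abs a + j < n}"
proof (rule finite_subset)
  show "{monomial_fun a j :: (real ^ 'd) \<times> real \<Rightarrow> real | a j. multi_abs a + j < n}
    \<subseteq> (\<lambda>(a, j). monomial_fun a j) ` ({a. multi_abs a \<le> n} \<times> {..n})"
    by force
qed (simp add: finite_multi_abs_le)

lemma sum_fun_apply: "(\<Sum>k\<in>K. f k) z = (\<Sum>k\<in>K. f k z)"
  by (induction K rule: infinite_finite_induct) simp_all

section \<open>The basis\<close>

text \<open>Counting against a basis of \<open>span N\<close> makes independence of \<open>N\<close> unnecessary; for \<open>N\<close> the
  monomials of degree less than \<open>n\<close> it would need a separate proof.\<close>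

lemma span_eq_of_complement:
  fixes U :: "'a::real_vector set"
  assumes U: "finite U" "independent U" "U \<subseteq> span (N \<union> T)"
    and T: "finite T" "card T \<le> card U"
    and N: "finite N"
    and disj: "span U \<inter> span N = {0}"
  shows "span (U \<union> N) = span (N \<union> T)"
proof -
  obtain B where B: "B \<subseteq> N" "independent B" "N \<subseteq> span B"
    using maximal_independent_subset[of N] by blast
  have B_fin: "finite B" using B(1) N by (rule finite_subset)
  have span_B: "span B = span N"
    using B by (intro equalityI span_mono span_minimal) auto
  have U_B: "U \<inter> B = {}"
  proof -
    have "x = 0" if "x \<in> U \<inter> B" for x
      using that disj span_base[of x U] span_base[of x B] by (auto simp: span_B)
    moreover have "0 \<notin> U" using U(2) dependent_zero by blast
    ultimately show ?thesis by blast
  qed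
  have indep: "independent (U \<union> B)"
  proof (rule independent_if_scalars_zero)
    fix f x
    assume sum: "(\<Sum>x\<in>U \<union> B. f x *\<^sub>R x) = 0" and x: "x \<in> U \<union> B"
    \<comment> \<open>The two parts of a vanishing combination are negatives of each other, so each
      lies in both spans and is zero.\<close>
    have eq: "(\<Sum>x\<in>U. f x *\<^sub>R x) = - (\<Sum>x\<in>B. f x *\<^sub>R x)"
      using sum U(1) B_fin U_B by (simp add: sum.union_disjoint eq_neg_iff_add_eq_0)
    have mem: "(\<Sum>x\<in>U. f x *\<^sub>R x) \<in> span U" "(\<Sum>x\<in>B. f x *\<^sub>R x) \<in> span N"
      unfolding span_B[symmetric] by (intro span_sum span_scale span_base; assumption)+
    then have "(\<Sum>x\<in>U. f x *\<^sub>R x) \<in> span N" unfolding eq by (intro span_neg)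
    with mem(1) disj have "(\<Sum>x\<in>U. f x *\<^sub>R x) = 0" by blast
    moreover from this eq have "(\<Sum>x\<in>B. f x *\<^sub>R x) = 0" by simp
    ultimately show "f x = 0"
      using x independentD[OF U(2) U(1) order_refl] independentD[OF B(2) B_fin order_refl] by blast
  qed (use U(1) B_fin in simp)
  have span_BT: "span (B \<union> T) = span (N \<union> T)"
    by (simp only: span_B span_Un)
  have "span (U \<union> B) = span (B \<union> T)"
  proof
    have sub: "U \<union> B \<subseteq> span (B \<union> T)"
      using U(3) span_superset[of "B \<union> T"] by (auto simp: span_BT)
    then show "span (U \<union> B) \<subseteq> span (B \<union> T)" by (intro span_minimal) auto
    \<comment> \<open>A vector outside would extend \<open>U \<union> B\<close> to an independent
      set with more elements than the spanning set \<open>B \<union> T\<close>.\<close>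
    show "span (B \<union> T) \<subseteq> span (U \<union> B)"
    proof (rule ccontr)
      assume "\<not> span (B \<union> T) \<subseteq> span (U \<union> B)"
      then obtain p where p: "p \<in> span (B \<union> T)" "p \<notin> span (U \<union> B)" by blast
      then have "card (insert p (U \<union> B)) \<le> card (B \<union> T)"
        using independent_span_bound[of "B \<union> T" "insert p (U \<union> B)"] indep sub B_fin T(1)
        by (simp add: independent_insertI)
      also have "\<dots> \<le> card B + card T" by (rule card_Un_le)
      also have "\<dots> \<le> card (U \<union> B)" using T(2) U(1) B_fin U_B by (simp add: card_Un_disjoint)
      finally show False
        using p(2) span_base[of p "U \<union> B"] U(1) B_fin by (auto simp: card_insert_if split: if_splits)
    qed
  qed
  moreover have "span (U \<union> B) = span (U \<union> N)" by (simp only: span_B span_Un)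
  ultimately show ?thesis using span_BT by simp
qed

context cone_parameters
begin

lemma subspace_orth_polys: "subspace (orth_polys \<beta> \<gamma> \<mu> n :: ((real ^ 'd::{finite,linorder}) \<times> real \<Rightarrow> real) set)"
  unfolding subspace_def
proof (intro conjI ballI allI)
  show "0 \<in> (orth_polys \<beta> \<gamma> \<mu> n :: ((real ^ 'd::{finite,linorder}) \<times> real \<Rightarrow> real) set)"
    by (simp add: orth_polys_def zero_fun_def inner_prod_eq)
next
  fix f g :: "(real ^ 'd::{finite,linorder}) \<times> real \<Rightarrow> real"
  assume "f \<in> orth_polys \<beta> \<gamma> \<mu> n" "g \<in> orth_polys \<beta> \<gamma> \<mu> n"
  then show "f + g \<in> orth_polys \<beta> \<gamma> \<mu> n"
    using inner_prod_add_left[of f "Suc n" g]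
    by (auto simp: orth_polys_def plus_fun_def)
next
  fix c and f :: "(real ^ 'd::{finite,linorder}) \<times> real \<Rightarrow> real"
  assume "f \<in> orth_polys \<beta> \<gamma> \<mu> n"
  then show "c *\<^sub>R f \<in> orth_polys \<beta> \<gamma> \<mu> n"
    by (auto simp: orth_polys_def scaleR_fun_def inner_prod_cmult_left)
qed

lemma orth_polys_Int_polys_lt:
  "(p :: (real ^ 'd::{finite,linorder}) \<times> real \<Rightarrow> real) \<in> orth_polys \<beta> \<gamma> \<mu> n \<Longrightarrow> p \<in> polys_lt n \<Longrightarrow> p = 0"
  using inner_prod_definite[of p n] by (auto simp: orth_polys_def zero_fun_def)

lemma UJ_biorthogonal:
  fixes kv :: "nat ^ 'd::{finite,linorder}"
  assumes "multi_abs kv \<le> n"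
  shows "UJ \<beta> \<gamma> \<mu> n kv \<in> orth_polys \<beta> \<gamma> \<mu> n"
    and "\<And>j l. multi_abs j \<le> n \<Longrightarrow>
      inner_prod (UJ \<beta> \<gamma> \<mu> n kv) (monomial_fun j (n - multi_abs j)) \<noteq> 0 \<Longrightarrow> kv $ l \<le> j $ l"
    and "inner_prod (UJ \<beta> \<gamma> \<mu> n kv) (monomial_fun kv (n - multi_abs kv)) \<noteq> 0"
proof -
  obtain u where u: "u \<in> polys_lt (Suc n)"
    "\<And>z. z \<in> interior solid_cone \<Longrightarrow> u z = rodrigues_cone \<beta> \<gamma> \<mu> n kv z"
    and orth: "\<And>j i. multi_abs j + i < n \<Longrightarrow> inner_prod u (monomial_fun j i) = 0"
    and le: "\<And>j i l. multi_abs j + i = n \<Longrightarrow> inner_prod u (monomial_fun j i) \<noteq> 0 \<Longrightarrow> kv $ l \<le> j $ l"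
    and nz: "inner_prod u (monomial_fun kv (n - multi_abs kv)) \<noteq> 0"
    using rodrigues_cone_biorthogonal[OF assms] by blast
  have UJ: "UJ \<beta> \<gamma> \<mu> n kv = u" by (rule UJ_eqI[OF u])
  have "inner_prod u q = 0" if "q \<in> polys_lt n" for q
    using that
  proof (induction rule: polys_lt_induct)
    case zero
    then show ?case by (simp add: inner_prod_eq)
  next
    case (add f g)
    then show ?case
      using inner_prod_add_left[of f n g u "Suc n"] u(1) by (simp add: inner_prod_commute[of u])
  next
    case (cmult c f)
    then show ?case by (simp add: inner_prod_commute[of u] inner_prod_cmult_left)
  qed (rule orth)
  then show "UJ \<beta> \<gamma> \<mu> n kv \<in> orth_polys \<beta> \<gamma> \<mu> n" by (simp add: UJ orth_polys_def u(1))
  show "kv $ l \<le> j $ l" if "multi_abs j \<le> n"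
      "inner_prod (UJ \<beta> \<gamma> \<mu> n kv) (monomial_fun j (n - multi_abs j)) \<noteq> 0" for j l
    using le[of j "n - multi_abs j" l] that by (simp add: UJ)
  show "inner_prod (UJ \<beta> \<gamma> \<mu> n kv) (monomial_fun kv (n - multi_abs kv)) \<noteq> 0"
    using nz by (simp add: UJ)
qed

text \<open>The matrix of pairings of the \<open>UJ\<close> with the monomials of degree \<open>n\<close> is triangular with respect to
  \<open>multi_abs\<close>, with nonzero diagonal.\<close>

lemma UJ_linear_independent:
  fixes c :: "nat ^ 'd::{finite,linorder} \<Rightarrow> real"
  assumes zero: "\<And>z. (\<Sum>k | multi_abs k \<le> n. c k * UJ \<beta> \<gamma> \<mu> n k z) = 0" and k: "multi_abs k \<le> n"
  shows "c k = 0"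
proof (rule ccontr)
  assume "c k \<noteq> 0"
  with k have "\<exists>j. multi_abs j \<le> n \<and> c j \<noteq> 0" by blast
  \<comment> \<open>The test monomial of \<open>j\<close> sees only indices below \<open>j\<close>
    componentwise. Minimality of \<open>multi_abs j\<close> among the nonzero coefficients leaves
    \<open>j\<close> alone.\<close>
  then obtain j where j: "multi_abs j \<le> n" "c j \<noteq> 0"
    and min: "\<And>i. multi_abs i \<le> n \<Longrightarrow> c i \<noteq> 0 \<Longrightarrow> multi_abs j \<le> multi_abs i"
    using ex_has_least_nat[of "\<lambda>j. multi_abs j \<le> n \<and> c j \<noteq> 0" _ multi_abs] by blast
  define T where "T = (monomial_fun j (n - multi_abs j) :: (real ^ 'd::{finite,linorder}) \<times> real \<Rightarrow> real)"
  have T: "T \<in> polys_lt (Suc n)" unfolding T_def using j by (intro monomial_fun_in_polys_lt) auto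
  have "0 = inner_prod (\<lambda>z. \<Sum>k | multi_abs k \<le> n. c k * UJ \<beta> \<gamma> \<mu> n k z) T"
    by (simp add: zero inner_prod_eq)
  also have "\<dots> = (\<Sum>k | multi_abs k \<le> n. c k * inner_prod (UJ \<beta> \<gamma> \<mu> n k) T)"
    using UJ_biorthogonal(1) T by (intro inner_prod_sum_left[where m = "Suc n"]) (auto simp: orth_polys_def)
  also have "\<dots> = (\<Sum>k\<in>{j}. c k * inner_prod (UJ \<beta> \<gamma> \<mu> n k) T)"
  proof (intro sum.mono_neutral_right finite_multi_abs_le ballI)
    fix i :: "nat ^ 'd::{finite,linorder}"
    assume i: "i \<in> {k. multi_abs k \<le> n} - {j}"
    show "c i * inner_prod (UJ \<beta> \<gamma> \<mu> n i) T = 0"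
    proof (rule ccontr)
      assume *: "c i * inner_prod (UJ \<beta> \<gamma> \<mu> n i) T \<noteq> 0"
      then have "multi_abs j \<le> multi_abs i" using min i by auto
      moreover have "i $ l \<le> j $ l" for l
        using * UJ_biorthogonal(2)[of i n j l] i j by (auto simp: T_def)
      ultimately show False using multi_abs_eq_imp_eq i by blast
    qed
  qed (use j in auto)
  also have "\<dots> = c j * inner_prod (UJ \<beta> \<gamma> \<mu> n j) T" by simp
  finally show False
    using j UJ_biorthogonal(3)[of j n] by (simp add: T_def)
qed

text \<open>Equal polynomials pair nontrivially with the diagonal monomials of both indices, so each
  index lies below the other.\<close>

lemma inj_on_UJ: "inj_on (UJ \<beta> \<gamma> \<mu> n) {k :: nat ^ 'd::{finite,linorder}. multi_abs k \<le> n}"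
proof (rule inj_onI)
  fix i j :: "nat ^ 'd::{finite,linorder}"
  assume ij: "i \<in> {k. multi_abs k \<le> n}" "j \<in> {k. multi_abs k \<le> n}" and eq: "UJ \<beta> \<gamma> \<mu> n i = UJ \<beta> \<gamma> \<mu> n j"
  have "i $ l \<le> j $ l" "j $ l \<le> i $ l" for l
    using UJ_biorthogonal(2)[of i n j l] UJ_biorthogonal(2)[of j n i l]
      UJ_biorthogonal(3)[of i n] UJ_biorthogonal(3)[of j n] ij eq by auto
  then show "i = j" by (simp add: vec_eq_iff le_antisym)
qed

lemma basis_family_UJ:
  "basis_family (UJ \<beta> \<gamma> \<mu> n) {k :: nat ^ 'd::{finite,linorder}. multi_abs k \<le> n} (orth_polys \<beta> \<gamma> \<mu> n)"
proof -
  define I where "I = {k :: nat ^ 'd::{finite,linorder}. multi_abs k \<le> n}"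
  define U where "U = UJ \<beta> \<gamma> \<mu> n ` I"
  define N where "N = {monomial_fun a j :: (real ^ 'd::{finite,linorder}) \<times> real \<Rightarrow> real | a j. multi_abs a + j < n}"
  \<comment> \<open>The monomials of degree exactly \<open>n\<close>: the exponent of
    \<open>t\<close> is determined by that of \<open>x\<close>, so they are indexed by the same set
    \<open>I\<close> as the family.\<close>
  define T where "T = (\<lambda>a. monomial_fun a (n - multi_abs a) :: (real ^ 'd::{finite,linorder}) \<times> real \<Rightarrow> real) ` I"
  have I: "finite I" unfolding I_def by (rule finite_multi_abs_le)
  have inj: "inj_on (UJ \<beta> \<gamma> \<mu> n) I" unfolding I_def by (rule inj_on_UJ)
  have NT: "polys_lt (Suc n) = span (N \<union> T)"
  proof -
    have "monomial_fun a j \<in> N \<union> T" if "multi_abs a + j < Suc n" for a j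
    proof (cases "multi_abs a + j < n")
      case True
      then show ?thesis by (auto simp: N_def)
    next
      case False
      with that have "j = n - multi_abs a" "a \<in> I" by (auto simp: I_def)
      then show ?thesis by (auto simp: T_def)
    qed
    moreover have "\<exists>a j. p = monomial_fun a j \<and> multi_abs a + j < Suc n" if "p \<in> N \<union> T" for p
      using that
    proof
      assume "p \<in> T"
      then obtain a where "p = monomial_fun a (n - multi_abs a)" "multi_abs a \<le> n"
        by (auto simp: T_def I_def)
      then show ?thesis by (intro exI[of _ a] exI[of _ "n - multi_abs a"]) simp
    qed (use less_SucI in \<open>unfold N_def, blast\<close>)
    ultimately have "{monomial_fun a j | a j. multi_abs a + j < Suc n} = N \<union> T"
      by blast
    then show ?thesis by (simp add: polys_lt_def)
  qed
  have N: "polys_lt n = span N" by (simp add: polys_lt_def N_def)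
  have U_orth: "span U \<subseteq> orth_polys \<beta> \<gamma> \<mu> n"
    using UJ_biorthogonal(1) by (intro span_minimal subspace_orth_polys) (auto simp: U_def I_def)
  have indep: "independent U"
  proof (rule independent_if_scalars_zero)
    fix f x
    assume sum: "(\<Sum>x\<in>U. f x *\<^sub>R x) = 0" and x: "x \<in> U"
    obtain k where k: "multi_abs k \<le> n" "x = UJ \<beta> \<gamma> \<mu> n k"
      using x by (auto simp: U_def I_def)
    have "(\<Sum>k\<in>I. f (UJ \<beta> \<gamma> \<mu> n k) * UJ \<beta> \<gamma> \<mu> n k z) = 0" for z
      using fun_cong[OF sum, of z] inj
      by (simp add: U_def sum.reindex sum_fun_apply scaleR_fun_def)
    then show "f x = 0"
      unfolding I_def k(2) by (rule UJ_linear_independent[OF _ k(1)])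
  qed (simp add: U_def I)
  have "span (U \<union> N) = span (N \<union> T)"
  proof (rule span_eq_of_complement[OF _ indep])
    show "U \<subseteq> span (N \<union> T)"
      using U_orth span_superset[of U] by (auto simp: orth_polys_def NT)
    show "card T \<le> card U"
      using card_image_le[OF I] card_image[OF inj] by (simp add: T_def U_def)
    show "finite N" unfolding N_def by (rule finite_monomial_funs)
    show "span U \<inter> span N = {0}"
      using U_orth orth_polys_Int_polys_lt by (auto simp: N span_zero)
  qed (simp_all add: U_def T_def I)
  have "p \<in> span U" if p: "p \<in> orth_polys \<beta> \<gamma> \<mu> n" for p
  proof -
    have "p \<in> span (U \<union> N)"
      using p unfolding \<open>span (U \<union> N) = _\<close> NT[symmetric] by (simp add: orth_polys_def)
    then obtain x y where xy: "p = x + y" "x \<in> span U" "y \<in> span N"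
      by (auto simp: span_Un)
    \<comment> \<open>The remainder \<open>y = p - x\<close> is orthogonal to
      \<open>polys_lt n\<close> and belongs to it, hence is orthogonal to itself.\<close>
    have "p - x \<in> orth_polys \<beta> \<gamma> \<mu> n"
      using p xy(2) U_orth by (intro subspace_diff[OF subspace_orth_polys]) auto
    then have "y = 0" using xy N by (intro orth_polys_Int_polys_lt) auto
    then show ?thesis using xy by simp
  qed
  then have "span U = orth_polys \<beta> \<gamma> \<mu> n" using U_orth by blast
  with inj indep show ?thesis unfolding basis_family_def U_def I_def by blast
qed

end

theorem theorem4p6:
  fixes \<mu> \<beta> \<gamma> :: real and n :: nat
  assumes "\<mu> > - 1/2" and "\<beta> > - real CARD('d::{finite,linorder})" and "\<gamma> > - 1"
    and "2 * \<mu> + \<beta> + real CARD('d::{finite,linorder}) > 0"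
  shows "basis_family
    (UJ \<beta> \<gamma> \<mu> n :: nat ^ 'd::{finite,linorder} \<Rightarrow> (real ^ 'd::{finite,linorder}) \<times> real \<Rightarrow> real)
    {k. multi_abs k \<le> n} (orth_polys \<beta> \<gamma> \<mu> n)"
proof -
  interpret cone_parameters \<mu> \<beta> \<gamma> "TYPE('d)"
    using assms by unfold_locales
  show ?thesis by (rule basis_family_UJ)
qed

end
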